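(* Let $f\in\mathbb{C}\{x,y\}$ be reduced with multiplicity $m(f)>1$. The following statements are equivalent: (1) $\tau(f)=\mu(f)$. (2) There exists $\omega\in S(f)$ such that $\{\omega, df\}$ is a Saito basis for $S(f)$. (3) $\mathcal{T}_f$ is a nontrivial cyclic $\mathcal{O}_f$-module.
   Context: $\mathbb{C}\{x,y\}$ is the ring of convergent power series; $f\in\mathbb{C}\{x,y\}$ is a reduced non-unit. The multiplicity $m(f)$ is the integer with $f\in\langle x,y\rangle^{m(f)}\setminus\langle x,y\rangle^{m(f)+1}$. $\Omega^1=\mathbb{C}\{x,y\}dx+\mathbb{C}\{x,y\}dy$ is the free module of germs of holomorphic 1-forms at $0\in\mathbb{C}^2$, and $df=f_xdx+f_ydy$. Put $F(f)=\{p\,df+f\eta:\ p\in\mathbb{C}\{x,y\},\ \eta\in\Omega^1\}$. The Saito module is $S(f)=\{\omega\in\Omega^1:\ g\omega\in F(f)\text{ for some } g\in\mathbb{C}\{x,y\}\text{ with }\gcd(g,f)=1\}$; equivalently, $\omega\in S(f)$ iff $\omega\wedge df=hf\,dx\wedge dy$ for some $h\in\mathbb{C}\{x,y\}$. It is a free $\mathbb{C}\{x,y\}$-module of rank 2; a Saito basis for $S(f)$ is a two-element $\mathbb{C}\{x,y\}$-basis $\{\omega_1,\omega_2\}$ of it (Saito's criterion: $\omega_1,\omega_2\in S(f)$ form a basis iff $\omega_1\wedge\omega_2=uf\,dx\wedge dy$ with $u$ a unit). $\mathcal{O}_f=\mathbb{C}\{x,y\}/\langle f\rangle$, $\Omega_f=\Omega^1/F(f)$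 is the Kähler differential module of $\mathcal{O}_f$, and $\mathcal{T}_f=S(f)/F(f)$ is its torsion submodule. "Nontrivial" means nonzero. $\mu(f)=\dim_{\mathbb{C}}\mathbb{C}\{x,y\}/\langle f_x,f_y\rangle$ and $\tau(f)=\dim_{\mathbb{C}}\mathbb{C}\{x,y\}/\langle f,f_x,f_y\rangle$ are the Milnor and Tjurina numbers. *)

theory Defs
  imports
    "HOL-Analysis.Infinite_Sum"
    "HOL-Library.Product_Plus"
    "HOL-Library.Extended_Nat"
    "HOL-Computational_Algebra.Formal_Power_Series"
    "HOL-Computational_Algebra.Squarefree"
    "HOL-Algebra.Algebraic_Closure_Type"
    "HOL-Algebra.Embedded_Algebras"
    "HOL-Algebra.Ideal_Product"
    "HOL-Algebra.QuotRing"
    "HOL-Algebra.Module"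
begin

section \<open>The ring of convergent power series in two variables\<close>

text \<open>
  A formal power series in two variables is an element of \<^typ>\<open>complex fps fps\<close>, that is,
  of \<open>\<complex>[[x]][[y]]\<close>: the coefficient of \<open>x\<^sup>i y\<^sup>j\<close> in \<open>F\<close> is \<open>F $ j $ i\<close>.
\<close>

definition convergent_fps2 :: "complex fps fps \<Rightarrow> bool" where
  "convergent_fps2 F \<longleftrightarrow>
     (\<exists>r>0. \<forall>u v. norm u < r \<and> norm v < r \<longrightarrow>
        (\<lambda>(i, j). F $ j $ i * u ^ i * v ^ j) summable_on UNIV)"

lemma convergent_fps2D:
  assumes "convergent_fps2 F"
  shows "\<exists>M B. \<forall>B'\<ge>B. 0 \<le> M \<and> 1 \<le> B \<and> (\<forall>i j. norm (F $ j $ i) \<le> M * B' ^ (i + j))"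
proof -
  from assms obtain r :: real where r: "r > 0"
    and sm: "\<And>u v. norm u < r \<and> norm v < r \<Longrightarrow>
        (\<lambda>(i, j). F $ j $ i * u ^ i * v ^ j) summable_on UNIV"
    unfolding convergent_fps2_def by blast
  define s where "s = r / 2"
  have s: "s > 0" "norm (complex_of_real s) < r" using r by (auto simp: s_def)
  have "(\<lambda>(i, j). F $ j $ i * (of_real s) ^ i * (of_real s) ^ j) summable_on UNIV"
    using sm s by blast
  hence abs: "(\<lambda>p. norm ((\<lambda>(i, j). F $ j $ i * (of_real s) ^ i * (of_real s) ^ j) p)) summable_on UNIV"
    using summable_on_iff_abs_summable_on_complex by blast
  define M where "M = infsum (\<lambda>p. norm ((\<lambda>(i, j). F $ j $ i * (of_real s) ^ i * (of_real s) ^ j) p)) UNIV"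
  have M0: "M \<ge> 0" unfolding M_def by (rule infsum_nonneg) auto
  have term_le: "norm (F $ j $ i) * s ^ (i + j) \<le> M" for i j
  proof -
    have "(\<Sum>p\<in>{(i, j)}. norm ((\<lambda>(i, j). F $ j $ i * (of_real s) ^ i * (of_real s) ^ j) p)) \<le> M"
      unfolding M_def by (rule finite_sum_le_infsum[OF abs]) auto
    thus ?thesis using s by (simp add: norm_mult norm_power power_add mult.assoc)
  qed
  define B where "B = max 1 (1 / s)"
  have "norm (F $ j $ i) \<le> M * B' ^ (i + j)" if "B' \<ge> B" for B' i j
  proof -
    have "1 / s \<le> B'" using that unfolding B_def by simp
    hence "(1 / s) ^ (i + j) \<le> B' ^ (i + j)" using s by (intro power_mono) auto
    hence "M * (1 / s) ^ (i + j) \<le> M * B' ^ (i + j)" using M0 by (intro mult_left_mono)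
    moreover have "norm (F $ j $ i) \<le> M * (1 / s) ^ (i + j)"
      using term_le[of j i] s by (simp add: field_simps power_divide)
    ultimately show ?thesis by linarith
  qed
  moreover have "1 \<le> B" unfolding B_def by simp
  ultimately show ?thesis using M0 by blast
qed

lemma convergent_fps2I:
  assumes bound: "\<And>i j. norm (F $ j $ i) \<le> M * B ^ (i + j)" and "B \<ge> 1"
  shows "convergent_fps2 F"
proof -
  have M0: "M \<ge> 0" using bound[of 0 0] by (simp add: order_trans[OF norm_ge_zero])
  define r where "r = 1 / (2 * B)"
  have r: "r > 0" using assms unfolding r_def by simp
  have geo: "(\<lambda>n. (1 / 2 :: real) ^ n) summable_on UNIV"
    by (rule norm_summable_imp_summable_on) (simp add: summable_geometric)
  have "(\<lambda>(i, j). F $ j $ i * u ^ i * v ^ j) summable_on UNIV"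
    if uv: "norm u < r" "norm v < r" for u v
  proof -
    have "(\<lambda>(i, j). M * (1/2) ^ i * (1/2) ^ j) summable_on (UNIV \<times> UNIV :: (nat \<times> nat) set)"
    proof (rule summable_on_SigmaI)
      show "((\<lambda>j. case (i, j) of (i, j) \<Rightarrow> M * (1/2) ^ i * (1/2) ^ j) has_sum
              (M * (1/2) ^ i * infsum (\<lambda>j. (1/2) ^ j) UNIV)) UNIV" for i :: nat
        using has_sum_cmult_right[OF has_sum_infsum[OF geo], of "M * (1/2) ^ i"] by simp
      show "(\<lambda>i::nat. M * (1/2) ^ i * infsum (\<lambda>j::nat. (1/2) ^ j) UNIV) summable_on UNIV"
        by (intro summable_on_cmult_left summable_on_cmult_right geo)
      show "\<And>i j. 0 \<le> (case (i, j) of (i :: nat, j :: nat) \<Rightarrow> M * (1/2) ^ i * (1/2) ^ j)"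
        using M0 by simp
    qed
    hence dom: "(\<lambda>(i, j). M * (1/2) ^ i * (1/2) ^ j) summable_on (UNIV :: (nat \<times> nat) set)"
      by simp
    have "(\<lambda>p. norm ((\<lambda>(i, j). F $ j $ i * u ^ i * v ^ j) p)) summable_on UNIV"
    proof (rule summable_on_comparison_test[OF dom])
      fix p :: "nat \<times> nat"
      obtain i j where p: "p = (i, j)" by (cases p)
      have "norm u ^ i \<le> r ^ i" "norm v ^ j \<le> r ^ j" using uv by (auto intro!: power_mono)
      hence "norm u ^ i * norm v ^ j \<le> r ^ i * r ^ j" using r by (intro mult_mono) auto
      hence "norm (F $ j $ i) * (norm u ^ i * norm v ^ j) \<le> (M * B ^ (i + j)) * (r ^ i * r ^ j)"
        using bound M0 \<open>B \<ge> 1\<close> by (intro mult_mono[of "norm (F $ j $ i)"]) auto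
      also have "\<dots> = M * (B * r) ^ i * (B * r) ^ j"
        by (simp add: power_add power_mult_distrib)
      also have "B * r = 1 / 2" using \<open>B \<ge> 1\<close> by (simp add: r_def)
      finally show "norm ((\<lambda>(i, j). F $ j $ i * u ^ i * v ^ j) p)
          \<le> (case p of (i, j) \<Rightarrow> M * (1/2) ^ i * (1/2) ^ j)"
        by (simp add: p norm_mult norm_power mult.assoc)
    qed auto
    thus ?thesis using summable_on_iff_abs_summable_on_complex by blast
  qed
  thus ?thesis unfolding convergent_fps2_def using r by blast
qed

lemma convergent_fps2_finite_support:
  assumes "\<And>i j. i > N \<or> j > N \<Longrightarrow> F $ j $ i = 0"
  shows "convergent_fps2 F"
proof (rule convergent_fps2I[where B = 1])
  show "norm (F $ j $ i) \<le> (\<Sum>(a, b)\<in>{..N}\<times>{..N}. norm (F $ b $ a)) * 1 ^ (i + j)" for i j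
  proof (cases "i > N \<or> j > N")
    case True
    thus ?thesis using assms by (auto intro!: sum_nonneg)
  next
    case False
    hence "(\<Sum>(a, b)\<in>{(i, j)}. norm (F $ b $ a)) \<le> (\<Sum>(a, b)\<in>{..N}\<times>{..N}. norm (F $ b $ a))"
      by (intro sum_mono2) auto
    thus ?thesis by simp
  qed
qed simp

lemma convergent_fps2_add:
  assumes "convergent_fps2 F" "convergent_fps2 G"
  shows "convergent_fps2 (F + G)"
proof -
  obtain M A where F: "\<And>B'. B' \<ge> A \<Longrightarrow> 0 \<le> M \<and> 1 \<le> A \<and> (\<forall>i j. norm (F $ j $ i) \<le> M * B' ^ (i + j))"
    using convergent_fps2D[OF assms(1)] by blast
  obtain N B where G: "\<And>B'. B' \<ge> B \<Longrightarrow> 0 \<le> N \<and> 1 \<le> B \<and> (\<forall>i j. norm (G $ j $ i) \<le> N * B' ^ (i + j))"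
    using convergent_fps2D[OF assms(2)] by blast
  define C where "C = max A B"
  have C: "C \<ge> A" "C \<ge> B" by (auto simp: C_def)
  show ?thesis
  proof (rule convergent_fps2I)
    show "norm ((F + G) $ j $ i) \<le> (M + N) * C ^ (i + j)" for i j
      using F[OF C(1)] G[OF C(2)] norm_triangle_ineq[of "F $ j $ i" "G $ j $ i"]
      by (simp add: distrib_right) (meson add_mono order_trans)
    show "C \<ge> 1" using F[OF C(1)] C by linarith
  qed
qed

lemma convergent_fps2_mult:
  assumes "convergent_fps2 F" "convergent_fps2 G"
  shows "convergent_fps2 (F * G)"
proof -
  obtain M A where F: "\<And>B'. B' \<ge> A \<Longrightarrow> 0 \<le> M \<and> 1 \<le> A \<and> (\<forall>i j. norm (F $ j $ i) \<le> M * B' ^ (i + j))"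
    using convergent_fps2D[OF assms(1)] by blast
  obtain N B where G: "\<And>B'. B' \<ge> B \<Longrightarrow> 0 \<le> N \<and> 1 \<le> B \<and> (\<forall>i j. norm (G $ j $ i) \<le> N * B' ^ (i + j))"
    using convergent_fps2D[OF assms(2)] by blast
  define C where "C = max A B"
  have C: "C \<ge> A" "C \<ge> B" by (auto simp: C_def)
  have C1: "C \<ge> 1" using F[OF C(1)] C by linarith
  have M0: "M \<ge> 0" and N0: "N \<ge> 0" using F[OF C(1)] G[OF C(2)] by auto
  have two: "real (Suc n) \<le> 2 ^ n" for n
    by (induction n) auto
  show ?thesis
  proof (rule convergent_fps2I)
    fix i j
    have "norm ((F * G) $ j $ i) =
        norm (\<Sum>b=0..j. \<Sum>a=0..i. F $ b $ a * G $ (j - b) $ (i - a))"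
      by (simp add: fps_mult_nth fps_sum_nth)
    also have "\<dots> \<le> (\<Sum>b=0..j. \<Sum>a=0..i. M * N * C ^ (i + j))"
    proof (intro sum_norm_le)
      fix a b assume ab: "b \<in> {0..j}" "a \<in> {0..i}"
      have "norm (F $ b $ a * G $ (j - b) $ (i - a))
          \<le> (M * C ^ (a + b)) * (N * C ^ ((i - a) + (j - b)))"
        unfolding norm_mult using F[OF C(1)] G[OF C(2)] C1 by (intro mult_mono[of "norm (F $ b $ a)"]) auto
      also have "\<dots> = M * N * C ^ ((a + b) + ((i - a) + (j - b)))"
        by (simp add: power_add)
      also have "(a + b) + ((i - a) + (j - b)) = i + j" using ab by auto
      finally show "norm (F $ b $ a * G $ (j - b) $ (i - a)) \<le> M * N * C ^ (i + j)" .
    qed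
    also have "\<dots> = (M * N * C ^ (i + j)) * (real (Suc i) * real (Suc j))" by simp
    also have "\<dots> \<le> (M * N * C ^ (i + j)) * (2 ^ i * 2 ^ j)"
      using M0 N0 C1 two by (intro mult_left_mono mult_mono) auto
    also have "\<dots> = (M * N) * (2 * C) ^ (i + j)"
      by (simp add: power_add power_mult_distrib)
    finally show "norm ((F * G) $ j $ i) \<le> (M * N) * (2 * C) ^ (i + j)" .
  qed (use C1 in simp)
qed

lemma convergent_fps2_uminus:
  assumes "convergent_fps2 F"
  shows "convergent_fps2 (- F)"
proof -
  obtain M A where "\<And>B'. B' \<ge> A \<Longrightarrow> 0 \<le> M \<and> 1 \<le> A \<and> (\<forall>i j. norm (F $ j $ i) \<le> M * B' ^ (i + j))"
    using convergent_fps2D[OF assms(1)] by blast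
  thus ?thesis by (intro convergent_fps2I[of "- F" M A]) auto
qed

typedef conv_series = "{F. convergent_fps2 F}"
  morphisms fps2_of Conv_series
  by (rule exI[of _ 0]) (auto intro: convergent_fps2_finite_support)

setup_lifting type_definition_conv_series

instantiation conv_series :: idom
begin

lift_definition zero_conv_series :: conv_series is 0
  by (rule convergent_fps2_finite_support) auto

lift_definition one_conv_series :: conv_series is 1
  by (rule convergent_fps2_finite_support[of 0]) auto

lift_definition plus_conv_series :: "conv_series \<Rightarrow> conv_series \<Rightarrow> conv_series" is "(+)"
  by (rule convergent_fps2_add)

lift_definition uminus_conv_series :: "conv_series \<Rightarrow> conv_series" is uminus
  by (rule convergent_fps2_uminus)

lift_definition minus_conv_series :: "conv_series \<Rightarrow> conv_series \<Rightarrow> conv_series" is "(-)"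
  using convergent_fps2_add convergent_fps2_uminus by fastforce

lift_definition times_conv_series :: "conv_series \<Rightarrow> conv_series \<Rightarrow> conv_series" is "(*)"
  by (rule convergent_fps2_mult)

instance
  by standard (transfer; simp add: algebra_simps)+

end

text \<open>
  Division (exact when possible, \<open>0\<close> otherwise) only serves to make \<^const>\<open>coprime\<close> available
  on \<^typ>\<open>conv_series\<close>.
\<close>

instantiation conv_series :: idom_divide
begin

definition divide_conv_series :: "conv_series \<Rightarrow> conv_series \<Rightarrow> conv_series" where
  "divide_conv_series a b = (if b \<noteq> 0 \<and> b dvd a then THE c. a = c * b else 0)"

instance
  by standard (auto simp: divide_conv_series_def)

end

instance conv_series :: algebraic_semidom ..

lift_definition cs_const :: "complex \<Rightarrow> conv_series" is "\<lambda>c. fps_const (fps_const c)"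
  by (rule convergent_fps2_finite_support[of 0]) auto

lift_definition cs_X :: conv_series is "fps_const fps_X"
  by (rule convergent_fps2_finite_support[of 1]) (auto simp: fps_X_def)

lift_definition cs_Y :: conv_series is "fps_X"
  by (rule convergent_fps2_finite_support[of 1]) (auto simp: fps_X_def)

lift_definition deriv_x :: "conv_series \<Rightarrow> conv_series" is "\<lambda>F. Abs_fps (\<lambda>j. fps_deriv (F $ j))"
proof -
  fix F :: "complex fps fps" assume "convergent_fps2 F"
  then obtain M A where F: "\<And>B'. B' \<ge> A \<Longrightarrow> 0 \<le> M \<and> 1 \<le> A \<and> (\<forall>i j. norm (F $ j $ i) \<le> M * B' ^ (i + j))"
    using convergent_fps2D by blast
  have two: "1 + real n \<le> 2 ^ n" for n
    by (induction n) auto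
  show "convergent_fps2 (Abs_fps (\<lambda>j. fps_deriv (F $ j)))"
  proof (rule convergent_fps2I)
    fix i j
    have "(1 + real i) * norm (F $ j $ Suc i) \<le> 2 ^ i * (M * A ^ (Suc i + j))"
      using F[of A] two by (intro mult_mono) (auto simp del: power_Suc add_Suc)
    also have "\<dots> \<le> 2 ^ (i + j) * (M * A ^ (Suc i + j))"
      using F[of A] by (intro mult_right_mono power_increasing) auto
    also have "\<dots> = M * A * (2 * A) ^ (i + j)"
      by (simp add: power_mult_distrib)
    finally show "norm (Abs_fps (\<lambda>j. fps_deriv (F $ j)) $ j $ i) \<le> M * A * (2 * A) ^ (i + j)"
      by (simp add: norm_mult flip: of_nat_Suc)
  qed (use F[of A] in simp)
qed

lift_definition deriv_y :: "conv_series \<Rightarrow> conv_series" is fps_deriv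
proof -
  fix F :: "complex fps fps" assume "convergent_fps2 F"
  then obtain M A where F: "\<And>B'. B' \<ge> A \<Longrightarrow> 0 \<le> M \<and> 1 \<le> A \<and> (\<forall>i j. norm (F $ j $ i) \<le> M * B' ^ (i + j))"
    using convergent_fps2D by blast
  have two: "1 + real n \<le> 2 ^ n" for n
    by (induction n) auto
  show "convergent_fps2 (fps_deriv F)"
  proof (rule convergent_fps2I)
    fix i j
    have "(1 + real j) * norm (F $ Suc j $ i) \<le> 2 ^ j * (M * A ^ (i + Suc j))"
      using F[of A] two by (intro mult_mono) (auto simp del: power_Suc add_Suc_right)
    also have "\<dots> \<le> 2 ^ (i + j) * (M * A ^ (i + Suc j))"
      using F[of A] by (intro mult_right_mono power_increasing) auto
    also have "\<dots> = M * A * (2 * A) ^ (i + j)"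
      by (simp add: power_mult_distrib)
    finally have *: "(1 + real j) * norm (F $ Suc j $ i) \<le> M * A * (2 * A) ^ (i + j)" .
    have "fps_deriv F $ j $ i = of_nat (Suc j) * F $ Suc j $ i"
      by (simp flip: fps_of_nat del: of_nat_Suc)
    thus "norm (fps_deriv F $ j $ i) \<le> M * A * (2 * A) ^ (i + j)"
      using * by (simp add: norm_mult del: of_nat_Suc) simp
  qed (use F[of A] in simp)
qed

abbreviation CS :: "conv_series ring" where
  "CS \<equiv> ring_of_type_algebra"

primrec max_ideal_power :: "nat \<Rightarrow> conv_series set" where
  "max_ideal_power 0 = carrier CS"
| "max_ideal_power (Suc k) = ideal_prod CS (Idl\<^bsub>CS\<^esub> {cs_X, cs_Y}) (max_ideal_power k)"

text \<open>Meaningful for \<open>f \<noteq> 0\<close> only.\<close>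

definition multiplicity0 :: "conv_series \<Rightarrow> nat" where
  "multiplicity0 f = (THE m. f \<in> max_ideal_power m \<and> f \<notin> max_ideal_power (Suc m))"


section \<open>Milnor and Tjurina numbers\<close>

text \<open>
  The complex dimension of \<open>\<complex>{x,y} / \<langle>S\<rangle>\<close>. The scalars are embedded in the quotient ring as the
  cosets of the constants. This image is a field unless the quotient is the zero ring, in which
  case the dimension is correctly \<open>0\<close>.
\<close>

definition quotient_dim :: "conv_series set \<Rightarrow> enat" where
  "quotient_dim S =
     (let I = Idl\<^bsub>CS\<^esub> S; Q = CS Quot I; K = range (\<lambda>c. I +>\<^bsub>CS\<^esub> cs_const c)
      in if ring.finite_dimension Q K (carrier Q) then enat ((ring.dim Q over K) (carrier Q))
         else \<infinity>)"

definition milnor_number :: "conv_series \<Rightarrow> enat" where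
  "milnor_number f = quotient_dim {deriv_x f, deriv_y f}"

definition tjurina_number :: "conv_series \<Rightarrow> enat" where
  "tjurina_number f = quotient_dim {f, deriv_x f, deriv_y f}"


section \<open>Holomorphic 1-forms and the Saito module\<close>

text \<open>The pair \<open>(A, B)\<close> stands for the form \<open>A dx + B dy\<close>.\<close>

type_synonym form1 = "conv_series \<times> conv_series"

definition form_scale :: "conv_series \<Rightarrow> form1 \<Rightarrow> form1" where
  "form_scale p \<omega> = (p * fst \<omega>, p * snd \<omega>)"

interpretation forms: Modules.module form_scale
  by standard (auto simp: form_scale_def algebra_simps)

definition differential :: "conv_series \<Rightarrow> form1" where
  "differential f = (deriv_x f, deriv_y f)"

definition F_module :: "conv_series \<Rightarrow> form1 set" where
  "F_module f = {form_scale p (differential f) + form_scale f \<eta> | p \<eta>. True}"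

definition saito_module :: "conv_series \<Rightarrow> form1 set" where
  "saito_module f = {\<omega>. \<exists>g. coprime g f \<and> form_scale g \<omega> \<in> F_module f}"

definition saito_basis :: "conv_series \<Rightarrow> form1 set \<Rightarrow> bool" where
  "saito_basis f B \<longleftrightarrow>
     card B = 2 \<and> forms.independent B \<and> forms.span B = saito_module f"


section \<open>The Kaehler differential module and its torsion submodule\<close>

definition local_ring :: "conv_series \<Rightarrow> conv_series set ring" where
  "local_ring f = CS Quot (PIdl\<^bsub>CS\<^esub> f)"

text \<open>The components \<open>mult\<close> and \<open>one\<close> of a module record are irrelevant.\<close>

definition Omega1 :: "(conv_series, form1) module" where
  "Omega1 = \<lparr>carrier = UNIV, monoid.mult = undefined, one = undefined,
     ring.zero = 0, add = (+), module.smult = form_scale\<rparr>"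

definition kaehler_module :: "conv_series \<Rightarrow> (conv_series set, form1 set) module" where
  "kaehler_module f =
     \<lparr>carrier = a_rcosets\<^bsub>Omega1\<^esub> (F_module f), monoid.mult = undefined, one = undefined,
      ring.zero = F_module f, add = set_add Omega1,
      module.smult = (\<lambda>P W. \<Union>p\<in>P. \<Union>\<omega>\<in>W. F_module f +>\<^bsub>Omega1\<^esub> (p \<odot>\<^bsub>Omega1\<^esub> \<omega>))\<rparr>"

lemma subspace_F_module: "forms.subspace (F_module f)"
proof (rule forms.subspaceI)
  show "0 \<in> F_module f" unfolding F_module_def by (auto simp: form_scale_def zero_prod_def intro!: exI[of _ 0])
next
  fix x y assume "x \<in> F_module f" "y \<in> F_module f"
  then obtain p e q g where "x = form_scale p (differential f) + form_scale f e" "y = form_scale q (differential f) + form_scale f g"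
    unfolding F_module_def by auto
  hence "x + y = form_scale (p+q) (differential f) + form_scale f (e+g)"
    by (simp add: algebra_simps)
  thus "x + y \<in> F_module f" unfolding F_module_def by blast
next
  fix c x assume "x \<in> F_module f"
  then obtain p e where "x = form_scale p (differential f) + form_scale f e" 
    unfolding F_module_def by auto
  hence "form_scale c x = form_scale (c*p) (differential f) + form_scale f (form_scale c e)"
    by (simp add: algebra_simps)
  thus "form_scale c x \<in> F_module f" unfolding F_module_def by blast
qed

lemma Omega1_coset: "F_module f +>\<^bsub>Omega1\<^esub> w = {e + w | e. e \<in> F_module f}"
  by (auto simp: a_r_coset_def r_coset_def Omega1_def)

lemma kaehler_coset_eq_iff:
  "F_module f +>\<^bsub>Omega1\<^esub> v = F_module f +>\<^bsub>Omega1\<^esub> w \<longleftrightarrow> v - w \<in> F_module f"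
proof
  assume "F_module f +>\<^bsub>Omega1\<^esub> v = F_module f +>\<^bsub>Omega1\<^esub> w"
  moreover have "v \<in> F_module f +>\<^bsub>Omega1\<^esub> v" unfolding Omega1_coset
    using forms.subspace_0[OF subspace_F_module] by force
  ultimately have "v \<in> {e + w | e. e \<in> F_module f}" unfolding Omega1_coset by simp
  thus "v - w \<in> F_module f" by auto
next
  assume vw: "v - w \<in> F_module f"
  have "\<exists>e'. e + v = e' + w \<and> e' \<in> F_module f" if "e \<in> F_module f" for e
    using forms.subspace_add[OF subspace_F_module that vw] by (intro exI[of _ "e + (v - w)"]) auto
  moreover have "\<exists>e'. e + w = e' + v \<and> e' \<in> F_module f" if "e \<in> F_module f" for e
    using forms.subspace_diff[OF subspace_F_module that vw] by (intro exI[of _ "e - (v - w)"]) auto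
  ultimately show "F_module f +>\<^bsub>Omega1\<^esub> v = F_module f +>\<^bsub>Omega1\<^esub> w"
    unfolding Omega1_coset by blast
qed

lemma local_ring_coset: "(PIdl\<^bsub>CS\<^esub> f) +>\<^bsub>CS\<^esub> p = {q * f + p | q. True}"
  by (auto simp: a_r_coset_def r_coset_def cgenideal_def ring_of_type_algebra_def)

lemma kaehler_smult:
  "((PIdl\<^bsub>CS\<^esub> f) +>\<^bsub>CS\<^esub> p) \<odot>\<^bsub>kaehler_module f\<^esub> (F_module f +>\<^bsub>Omega1\<^esub> w)
     = F_module f +>\<^bsub>Omega1\<^esub> (form_scale p w)"
proof -
  have "F_module f +>\<^bsub>Omega1\<^esub> (p' \<odot>\<^bsub>Omega1\<^esub> w') = F_module f +>\<^bsub>Omega1\<^esub> (form_scale p w)"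
    if p': "p' \<in> (PIdl\<^bsub>CS\<^esub> f) +>\<^bsub>CS\<^esub> p" and w': "w' \<in> F_module f +>\<^bsub>Omega1\<^esub> w" for p' w'
  proof -
    obtain q e where qe: "p' = q * f + p" "w' = e + w" "e \<in> F_module f"
      using p' w' unfolding local_ring_coset Omega1_coset by blast
    have "form_scale p' w' - form_scale p w = form_scale p' e + (form_scale 0 (differential f) + form_scale f (form_scale q w))"
      by (simp add: qe algebra_simps)
    also have "\<dots> \<in> F_module f"
      using forms.subspace_scale[OF subspace_F_module qe(3), of p']
      by (rule forms.subspace_add[OF subspace_F_module]) (unfold F_module_def, blast)
    finally show ?thesis by (simp add: kaehler_coset_eq_iff Omega1_def[THEN arg_cong[of _ _ module.smult]])
  qed
  moreover have "p \<in> (PIdl\<^bsub>CS\<^esub> f) +>\<^bsub>CS\<^esub> p" unfolding local_ring_coset by (auto intro: exI[of _ 0])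
  moreover have "w \<in> F_module f +>\<^bsub>Omega1\<^esub> w" unfolding Omega1_coset
    using forms.subspace_0[OF subspace_F_module] by force
  ultimately show ?thesis unfolding kaehler_module_def by (auto 0 3)
qed

definition torsion_module :: "conv_series \<Rightarrow> (conv_series set, form1 set) module" where
  "torsion_module f =
     (kaehler_module f)\<lparr>carrier := {F_module f +>\<^bsub>Omega1\<^esub> \<omega> | \<omega>. \<omega> \<in> saito_module f}\<rparr>"

definition nontrivial_module :: "('a, 'b) module \<Rightarrow> bool" where
  "nontrivial_module M \<longleftrightarrow> carrier M \<noteq> {\<zero>\<^bsub>M\<^esub>}"

definition cyclic_module :: "'a ring \<Rightarrow> ('a, 'b) module \<Rightarrow> bool" where
  "cyclic_module R M \<longleftrightarrow> (\<exists>t\<in>carrier M. carrier M = {r \<odot>\<^bsub>M\<^esub> t | r. r \<in> carrier R})"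

end

theory Submission
  imports Defs
begin

text \<open>
  Write \<open>J = \<langle>f\<^sub>x, f\<^sub>y\<rangle>\<close> and \<open>I = \<langle>f, f\<^sub>x, f\<^sub>y\<rangle>\<close>. All three statements are equivalent to \<open>f \<in> J\<close>.

  The only analytic input is Weierstrass division by series not divisible by \<open>x\<close>. It shows that an
  ideal from which \<open>x\<close> can be cancelled is principal. Applied to colon ideals this gives Euclid's
  lemma; applied to the saturation of an ideal without common divisors it gives a power of \<open>x\<close> in
  that ideal, hence finite codimension. For squarefree \<open>f\<close> the ideal \<open>I\<close> has no common divisor, so
  \<open>\<tau>(f)\<close> is finite, and \<open>\<tau>(f) = \<mu>(f)\<close> holds iff \<open>I = J\<close>.

  Euclid's lemma and an element of \<open>I\<close> coprime to \<open>f\<close> show that \<open>\<omega> \<in> S(f)\<close> iff \<open>f\<close> divides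
  \<open>\<omega> \<and> df\<close>; so \<open>{\<omega>, df}\<close> is a basis iff \<open>\<omega> \<and> df\<close> is a unit times \<open>f\<close>. If \<open>\<omega>\<close> generates the
  torsion module, then \<open>\<omega>, df, f dx, f dy\<close> generate \<open>S(f)\<close>, but by Nakayama's lemma two elements
  suffice; comparing the wedge products of both sets of generators makes \<open>\<omega> \<and> df\<close> a unit times
  \<open>f\<close>. This uses that no element of \<open>S(f)\<close> has a unit as a coefficient.
\<close>

section \<open>Coefficients and derivatives\<close>


text \<open>The exponent of x comes first here, whereas the nested series is indexed by the exponent
  of y first.\<close>

definition cf :: "conv_series \<Rightarrow> nat \<Rightarrow> nat \<Rightarrow> complex" where
  "cf F i j = fps2_of F $ j $ i"

lemma conv_series_eqI: "(\<And>i j. cf F i j = cf G i j) \<Longrightarrow> F = G"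
  by (auto simp: cf_def fps_eq_iff simp flip: fps2_of_inject)

lemma cf_simps [simp]:
  "cf 0 i j = 0"
  "cf 1 i j = (if i = 0 \<and> j = 0 then 1 else 0)"
  "cf (F + G) i j = cf F i j + cf G i j"
  "cf (- F) i j = - cf F i j"
  "cf (F - G) i j = cf F i j - cf G i j"
  "cf (cs_const c) i j = (if i = 0 \<and> j = 0 then c else 0)"
  unfolding cf_def by (transfer; simp)+

lemma cf_mult: "cf (F * G) i j = (\<Sum>b=0..j. \<Sum>a=0..i. cf F a b * cf G (i - a) (j - b))"
  unfolding cf_def by transfer (simp add: fps_mult_nth fps_sum_nth)

lemma cf_X_mult [simp]: "cf (cs_X * F) i j = (if i = 0 then 0 else cf F (i - 1) j)"
  unfolding cf_def by transfer simp

lemma cf_Y_mult [simp]: "cf (cs_Y * F) i j = (if j = 0 then 0 else cf F i (j - 1))"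
  unfolding cf_def by transfer simp

lemma cf_const_mult [simp]: "cf (cs_const c * F) i j = c * cf F i j"
  unfolding cf_def by transfer simp

lemma cf_deriv_x [simp]: "cf (deriv_x F) i j = of_nat (Suc i) * cf F (Suc i) j"
  unfolding cf_def by transfer simp

lemma cf_deriv_y [simp]: "cf (deriv_y F) i j = of_nat (Suc j) * cf F i (Suc j)"
  unfolding cf_def by transfer (simp flip: fps_of_nat del: of_nat_Suc)

lemma cf_exists: "convergent_fps2 F \<Longrightarrow> \<exists>G. \<forall>i j. cf G i j = F $ j $ i"
  unfolding cf_def by (metis Conv_series_inverse mem_Collect_eq)

lemma cf_bound:
  obtains M B where "0 \<le> M" "1 \<le> B" "\<And>i j. norm (cf F i j) \<le> M * B ^ (i + j)"
  using convergent_fps2D[of "fps2_of F"] fps2_of[of F] unfolding cf_def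
  by (metis (full_types) mem_Collect_eq order_refl)

text \<open>The quotient is F with its x-exponents lowered by one. If the coefficients of F are
  bounded by \<open>M * B ^ (i + j)\<close>, those of the quotient are bounded with
  \<open>M * B\<close> in place of \<open>M\<close>, so it converges.\<close>

lemma cs_X_dvd_iff: "cs_X dvd F \<longleftrightarrow> (\<forall>j. cf F 0 j = 0)"
proof
  assume "cs_X dvd F"
  then show "\<forall>j. cf F 0 j = 0" by (auto elim!: dvdE)
next
  assume *: "\<forall>j. cf F 0 j = 0"
  obtain M B where B: "0 \<le> M" "1 \<le> B" "\<And>i j. norm (cf F i j) \<le> M * B ^ (i + j)"
    using cf_bound[of F] by blast
  define H where "H = Abs_fps (\<lambda>j. Abs_fps (\<lambda>i. cf F (Suc i) j))"
  have "convergent_fps2 H"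
  proof (rule convergent_fps2I)
    show "norm (H $ j $ i) \<le> (M * B) * B ^ (i + j)" for i j
      using B(3)[of "Suc i" j] by (simp add: H_def mult.assoc)
  qed (use B in simp)
  then obtain G where G: "\<And>i j. cf G i j = cf F (Suc i) j"
    using cf_exists[of H] by (auto simp: H_def)
  have "F = cs_X * G"
    by (rule conv_series_eqI) (use * in \<open>simp add: G\<close>)
  then show "cs_X dvd F" by simp
qed

lemma cs_X_power_dvd_iff: "cs_X ^ N dvd F \<longleftrightarrow> (\<forall>i<N. \<forall>j. cf F i j = 0)"
proof (induction N arbitrary: F)
  case (Suc N)
  show ?case
  proof
    assume "cs_X ^ Suc N dvd F"
    then obtain G where "F = cs_X ^ Suc N * G" by (rule dvdE)
    then have F: "F = cs_X * (cs_X ^ N * G)" by (simp add: mult.assoc)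
    have "\<forall>i<N. \<forall>j. cf (cs_X ^ N * G) i j = 0" using Suc.IH[of "cs_X ^ N * G"] by simp
    then show "\<forall>i<Suc N. \<forall>j. cf F i j = 0" by (simp add: F)
  next
    assume *: "\<forall>i<Suc N. \<forall>j. cf F i j = 0"
    then obtain G where F: "F = cs_X * G" using cs_X_dvd_iff[of F] by (auto elim!: dvdE)
    have "cf G i j = 0" if "i < N" for i j using *[rule_format, of "Suc i" j] that by (simp add: F)
    then show "cs_X ^ Suc N dvd F" using Suc.IH[of G] by (simp add: F)
  qed
qed simp

lemma deriv_add: "deriv_x (F + G) = deriv_x F + deriv_x G" "deriv_y (F + G) = deriv_y F + deriv_y G"
  by (auto intro!: conv_series_eqI simp: algebra_simps)

lemma deriv_y_mult: "deriv_y (F * G) = deriv_y F * G + F * deriv_y G"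
  by transfer (simp add: add.commute)

lemma deriv_x_mult: "deriv_x (F * G) = deriv_x F * G + F * deriv_x G"
proof (transfer, rule fps_ext)
  fix F G :: "complex fps fps" and n
  show "Abs_fps (\<lambda>j. fps_deriv ((F * G) $ j)) $ n =
      (Abs_fps (\<lambda>j. fps_deriv (F $ j)) * G + F * Abs_fps (\<lambda>j. fps_deriv (G $ j))) $ n"
    by (simp add: fps_mult_nth fps_deriv_sum sum.distrib add.commute)
qed

lemma deriv_commute: "deriv_x (deriv_y F) = deriv_y (deriv_x F)"
  by (rule conv_series_eqI) simp

lemma cs_X_not_unit: "\<not> is_unit cs_X"
  using cs_X_dvd_iff[of 1] by auto

lemma cs_X_nonzero [simp]: "cs_X \<noteq> 0"
  using cf_X_mult[of 1 1 0] by auto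


section \<open>Weierstrass division\<close>

text \<open>
  For a divisor \<open>h\<close> with \<open>h(0,y)\<close> of order \<open>e\<close>, give \<open>x\<close> the weight \<open>e + 1\<close> and \<open>y\<close> the weight \<open>1\<close>.
  Then \<open>h = c y\<^sup>e + k\<close> with all terms of \<open>k\<close> of weight greater than \<open>e\<close>, and the quotient is
  the solution of \<open>c q = shift (g - q k)\<close>, where \<open>shift\<close> drops the terms of \<open>y\<close>-degree less than
  \<open>e\<close> and divides by \<open>y\<^sup>e\<close>: the map \<open>q \<mapsto> shift (q k)\<close> raises the weight.
\<close>

abbreviation wt :: "nat \<Rightarrow> nat \<Rightarrow> nat \<Rightarrow> nat" where
  "wt e i j \<equiv> Suc e * i + j"

section \<open>Formal solution of the division equation\<close>

lemma shift_mult_nth: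
  fixes q k :: "complex fps fps"
  shows "fps_shift e (q * k) $ j $ i = (\<Sum>b=0..j+e. \<Sum>a=0..i. q $ b $ a * k $ (j + e - b) $ (i - a))"
  by (simp add: fps_mult_nth fps_sum_nth)

text \<open>Weights add up along a convolution. The excess \<open>e\<close> on the right comes from
  the shift: output exponent \<open>j\<close> collects products of y-degree
  \<open>j + e\<close>.\<close>

lemma wt_add: "a \<le> i \<Longrightarrow> b \<le> j + e \<Longrightarrow> wt e a b + wt e (i - a) (j + e - b) = wt e i j + e"
proof -
  assume "a \<le> i" "b \<le> j + e"
  then obtain i' j' where "i = a + i'" "j + e = b + j'" by (metis le_iff_add)
  then show ?thesis by (simp add: algebra_simps)
qed

text \<open>A fixed point iteration in the weight-adic topology. The coefficients of weight w do not
  change any more from the iterate w + 1 on, and the limit takes them from there.\<close>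

lemma formal_weierstrass_quotient:
  fixes g k :: "complex fps fps" and c :: complex
  assumes c: "c \<noteq> 0" and k: "\<And>i j. wt e i j \<le> e \<Longrightarrow> k $ j $ i = 0"
  obtains q :: "complex fps fps" where "fps_const (fps_const c) * q = fps_shift e (g - q * k)"
proof -
  define C where "C = (fps_const (fps_const (inverse c)) :: complex fps fps)"
  define step where "step q = C * fps_shift e (g - q * k)" for q
  define Q where "Q n = (step ^^ n) 0" for n
  have QS: "Q (Suc n) = step (Q n)" for n by (simp add: Q_def)
  have diff: "step p - step q = - (C * fps_shift e ((p - q) * k))" for p q
    by (simp add: step_def algebra_simps fps_shift_diff fps_shift_add)
  \<comment> \<open>Since \<open>k\<close> has only terms of weight above \<open>e\<close>, a
    coefficient of \<open>step p - step q\<close> involves only coefficients of \<open>p - q\<close>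
    of strictly smaller weight.\<close>
  have agree: "(step p - step q) $ j $ i = 0"
    if zero: "\<And>a b. wt e a b < wt e i j \<Longrightarrow> (p - q) $ b $ a = 0" for p q i j
  proof -
    have "(p - q) $ b $ a * k $ (j + e - b) $ (i - a) = 0" if "a \<le> i" "b \<le> j + e" for a b
    proof (cases "wt e (i - a) (j + e - b) \<le> e")
      case False
      then have "wt e a b < wt e i j" using wt_add[OF that] by linarith
      then show ?thesis using zero by simp
    qed (use k in simp)
    then have "fps_shift e ((p - q) * k) $ j $ i = 0"
      unfolding shift_mult_nth by (intro sum.neutral ballI) simp
    then show ?thesis unfolding diff by (simp add: C_def)
  qed
  have succ: "(Q (Suc n) - Q n) $ j $ i = 0" if "wt e i j < n" for n i j
    using that
  proof (induction n arbitrary: i j)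
    case (Suc n)
    have "(step (Q (Suc n)) - step (Q n)) $ j $ i = 0"
    proof (rule agree)
      fix a b assume "wt e a b < wt e i j"
      then have "wt e a b < n" using Suc.prems by (rule less_le_trans[OF _ less_Suc_eq_le[THEN iffD1]])
      then show "(Q (Suc n) - Q n) $ b $ a = 0" by (rule Suc.IH)
    qed
    then show ?case by (simp only: QS)
  qed simp
  have stable: "Q n $ j $ i = Q (Suc (wt e i j)) $ j $ i" if "wt e i j < n" for n i j
    using that
  proof (induction n)
    case (Suc n)
    then show ?case using succ[of i j n] by (cases "wt e i j < n") (auto simp: less_Suc_eq)
  qed simp
  define q where "q = Abs_fps (\<lambda>j. Abs_fps (\<lambda>i. Q (Suc (wt e i j)) $ j $ i))"
  have "q = step q"
  proof (intro fps_ext)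
    fix i j
    define n where "n = Suc (wt e i j)"
    have "(step (Q n) - step q) $ j $ i = 0"
    proof (rule agree)
      fix a b assume "wt e a b < wt e i j"
      then have "wt e a b < n" by (simp add: n_def)
      then have "Q n $ b $ a = q $ b $ a" unfolding q_def fps_nth_Abs_fps by (rule stable)
      then show "(Q n - q) $ b $ a = 0" by simp
    qed
    moreover have "Q (Suc n) $ j $ i = q $ j $ i"
      unfolding q_def using stable[of i j "Suc n"] by (simp add: n_def)
    ultimately show "q $ j $ i = step q $ j $ i" by (simp add: QS)
  qed
  then have "fps_const (fps_const c) * q = fps_const (fps_const c) * step q" by simp
  also have "\<dots> = fps_shift e (g - q * k)"
    using c by (simp add: step_def C_def flip: mult.assoc)
  finally show ?thesis by (rule that)
qed

section \<open>Weighted norms and convergence of the quotient\<close>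

definition trunc_norm :: "nat \<Rightarrow> real \<Rightarrow> nat \<Rightarrow> complex fps fps \<Rightarrow> real" where
  "trunc_norm e t n F = (\<Sum>(i,j)\<in>{(i,j). wt e i j \<le> n}. norm (F $ j $ i) * t ^ wt e i j)"

lemma finite_wt_le [simp]: "finite {(i,j). i + e * i + j \<le> (n :: nat)}"
  by (rule finite_subset[of _ "{..n} \<times> {..n}"]) auto

lemma trunc_norm_nonneg: "t \<ge> 0 \<Longrightarrow> trunc_norm e t n F \<ge> 0"
  unfolding trunc_norm_def by (intro sum_nonneg) auto

text \<open>Submultiplicativity of the weighted l1 norm in which x has size \<open>t ^ Suc e\<close>
  and y has size \<open>t\<close>; the cut-off keeps it finite before convergence is known. In a
  nonzero product the factor from \<open>k\<close> has weight above \<open>e\<close>, so the factor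
  from \<open>q\<close> has weight below that of the output. Hence \<open>q\<close> needs no larger
  cut-off on the right than the shifted product on the left.\<close>

lemma trunc_norm_shift_mult_le:
  assumes t: "t > 0" and k: "\<And>i j. wt e i j \<le> e \<Longrightarrow> k $ j $ i = 0"
  shows "trunc_norm e t n (fps_shift e (q * k)) * t ^ e \<le> trunc_norm e t n q * trunc_norm e t (n + e) k"
proof -
  define S where "S m = {(i,j). wt e i j \<le> m}" for m
  have fin: "finite (S m)" for m unfolding S_def by simp
  define Q where "Q = (\<lambda>(a,b). norm (q $ b $ a) * t ^ wt e a b)"
  define K where "K = (\<lambda>(a,b). norm (k $ b $ a) * t ^ wt e a b)"
  define D where "D = Sigma (S n) (\<lambda>(i,j). {0..j+e} \<times> {0..i})"
  define F where "F = (\<lambda>((i,j),(b,a)). Q (a,b) * K (i - a, j + e - b))"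
  have nonneg: "Q x \<ge> 0" "K x \<ge> 0" for x using t by (auto simp: Q_def K_def split: prod.split)
  have finD: "finite D" unfolding D_def by (rule finite_SigmaI[OF fin]) auto
  have "trunc_norm e t n (fps_shift e (q * k)) * t ^ e
      = (\<Sum>(i,j)\<in>S n. norm (fps_shift e (q * k) $ j $ i) * t ^ (wt e i j + e))"
    unfolding trunc_norm_def S_def sum_distrib_right by (intro sum.cong) (auto simp: power_add)
  also have "\<dots> \<le> (\<Sum>x\<in>S n. sum (\<lambda>y. F (x, y)) (case x of (i,j) \<Rightarrow> {0..j+e} \<times> {0..i}))"
  proof (intro sum_mono, clarify)
    fix i j
    have "norm (fps_shift e (q * k) $ j $ i)
        \<le> (\<Sum>b=0..j+e. \<Sum>a=0..i. norm (q $ b $ a) * norm (k $ (j + e - b) $ (i - a)))"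
      unfolding shift_mult_nth norm_mult[symmetric] by (intro sum_norm_le order_refl)
    then have "norm (fps_shift e (q * k) $ j $ i) * t ^ (wt e i j + e)
        \<le> (\<Sum>b=0..j+e. \<Sum>a=0..i. norm (q $ b $ a) * norm (k $ (j + e - b) $ (i - a))) * t ^ (wt e i j + e)"
      using t by (intro mult_right_mono) auto
    also have "\<dots> = (\<Sum>b=0..j+e. \<Sum>a=0..i. F ((i,j),(b,a)))"
      unfolding sum_distrib_right
    proof (intro sum.cong refl)
      fix a b assume "b \<in> {0..j+e}" "a \<in> {0..i}"
      then have "t ^ (wt e i j + e) = t ^ wt e a b * t ^ wt e (i - a) (j + e - b)"
        using wt_add[of a i b j e] by (simp only: atLeastAtMost_iff flip: power_add)
      then show "norm (q $ b $ a) * norm (k $ (j + e - b) $ (i - a)) * t ^ (wt e i j + e) = F ((i,j),(b,a))"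
        by (simp only: F_def Q_def K_def prod.case mult_ac)
    qed
    finally show "norm (fps_shift e (q * k) $ j $ i) * t ^ (wt e i j + e)
        \<le> (\<Sum>y\<in>{0..j+e} \<times> {0..i}. F ((i,j),y))"
      unfolding sum.cartesian_product by (simp add: case_prod_unfold)
  qed
  also have "\<dots> = sum F D"
    unfolding D_def using fin by (subst sum.Sigma) (auto simp: case_prod_unfold)
  also have "\<dots> = sum F {x\<in>D. F x \<noteq> 0}"
    using finD by (intro sum.mono_neutral_right) auto
  also have "\<dots> \<le> (\<Sum>(x,y)\<in>S n \<times> S (n + e). Q x * K y)"
  proof -
    \<comment> \<open>The summand with output (i,j) and inner indices (b,a) is matched with the
      exponent pairs (a,b) and (i - a, j + e - b). Adding these and subtracting e from the
      y-exponent recovers the output, so the matching is injective.\<close>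
    have *: "\<forall>x\<in>{x\<in>D. F x \<noteq> 0}. \<exists>y\<in>S n \<times> S (n + e).
        (case y of ((a,b),(a',b')) \<Rightarrow> ((a + a', b + b' - e), (b, a))) = x \<and> F x \<le> (case y of (x,y) \<Rightarrow> Q x * K y)"
    proof
      fix x assume "x \<in> {x \<in> D. F x \<noteq> 0}"
      moreover obtain i j b a where x: "x = ((i,j),(b,a))" by (metis surj_pair)
      ultimately have ab: "wt e i j \<le> n" "a \<le> i" "b \<le> j + e" and ne: "F ((i,j),(b,a)) \<noteq> 0"
        by (auto simp: D_def S_def)
      have "\<not> wt e (i - a) (j + e - b) \<le> e"
        using ne k[of "i - a" "j + e - b"] by (auto simp: F_def K_def)
      then have "(a,b) \<in> S n" "(i - a, j + e - b) \<in> S (n + e)"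
        using wt_add[OF ab(2,3)] ab(1) by (auto simp: S_def)
      moreover have "a + (i - a) = i" "b + (j + e - b) - e = j" using ab by auto
      ultimately show "\<exists>y\<in>S n \<times> S (n + e).
          (case y of ((a,b),(a',b')) \<Rightarrow> ((a + a', b + b' - e), (b, a))) = x \<and> F x \<le> (case y of (x,y) \<Rightarrow> Q x * K y)"
        unfolding x by (intro bexI[of _ "((a,b),(i - a, j + e - b))"]) (auto simp: F_def)
    qed
    show ?thesis
      by (rule sum_le_included[OF _ _ _ *]) (use fin finD nonneg in auto)
  qed
  also have "\<dots> = sum Q (S n) * sum K (S (n + e))"
    by (simp add: sum_product sum.cartesian_product)
  finally show ?thesis by (simp add: trunc_norm_def Q_def K_def S_def)
qed

lemma trunc_norm_shift_le:
  assumes t: "t > 0"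
  shows "trunc_norm e t n (fps_shift e g) * t ^ e \<le> trunc_norm e t (n + e) g"
proof -
  have "trunc_norm e t n (fps_shift e g) * t ^ e
      = (\<Sum>(i,j)\<in>{(i,j). wt e i j \<le> n}. norm (g $ (j + e) $ i) * t ^ wt e i (j + e))"
    unfolding trunc_norm_def sum_distrib_right by (intro sum.cong) (auto simp: power_add)
  also have "\<dots> \<le> trunc_norm e t (n + e) g"
    unfolding trunc_norm_def
  proof (rule sum_le_included[where i = "\<lambda>(i,j). (i, j - e)"])
    show "\<forall>x\<in>{(i,j). wt e i j \<le> n}. \<exists>y\<in>{(i,j). wt e i j \<le> n + e}. (case y of (i,j) \<Rightarrow> (i, j - e)) = x \<and>
        (case x of (i,j) \<Rightarrow> norm (g $ (j + e) $ i) * t ^ wt e i (j + e)) \<le>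
        (case y of (i,j) \<Rightarrow> norm (g $ j $ i) * t ^ wt e i j)"
    proof safe
      fix i j assume "wt e i j \<le> n"
      then show "\<exists>y\<in>{(i,j). wt e i j \<le> n + e}. (case y of (i,j) \<Rightarrow> (i, j - e)) = (i, j) \<and>
        norm (g $ (j + e) $ i) * t ^ wt e i (j + e) \<le> (case y of (i,j) \<Rightarrow> norm (g $ j $ i) * t ^ wt e i j)"
        by (intro bexI[of _ "(i, j + e)"]) auto
    qed
  qed (use t in auto)
  finally show ?thesis .
qed

text \<open>With T = 1 / (2 B), and because the weight is at least i + j, the sum is dominated by M
  times a product of two geometric series with ratio 1/2, each at most 2.\<close>

lemma trunc_norm_bounded:
  assumes "convergent_fps2 F"
  obtains T K where "0 < T" "T \<le> 1" "0 \<le> K" "\<And>n. trunc_norm e T n F \<le> K"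
proof -
  obtain M B where F: "\<And>B'. B' \<ge> B \<Longrightarrow> 0 \<le> M \<and> 1 \<le> B \<and> (\<forall>i j. norm (F $ j $ i) \<le> M * B' ^ (i + j))"
    using convergent_fps2D[OF assms] by blast
  have M: "0 \<le> M" and B: "1 \<le> B" and bound: "norm (F $ j $ i) \<le> M * B ^ (i + j)" for i j
    using F[of B] by auto
  have geo: "(\<Sum>i\<le>m. (1/2 :: real) ^ i) \<le> 2" for m
    by (subst sum_gp0) (simp add: field_simps)
  have "trunc_norm e (1 / (2 * B)) n F \<le> M * 4" for n
  proof -
    have "trunc_norm e (1 / (2 * B)) n F \<le> (\<Sum>(i,j)\<in>{(i,j). wt e i j \<le> n}. M * ((1/2) ^ i * (1/2) ^ j))"
      unfolding trunc_norm_def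
    proof (intro sum_mono, clarify)
      fix i j
      have "norm (F $ j $ i) * (1 / (2 * B)) ^ wt e i j \<le> (M * B ^ (i + j)) * (1 / (2 * B)) ^ (i + j)"
        using B M bound by (intro mult_mono power_decreasing) auto
      also have "\<dots> = M * ((1/2) ^ i * (1/2) ^ j)"
        using B by (simp add: power_add power_mult_distrib power_divide field_simps)
      finally show "norm (F $ j $ i) * (1 / (2 * B)) ^ wt e i j \<le> M * ((1/2) ^ i * (1/2) ^ j)" .
    qed
    also have "\<dots> \<le> (\<Sum>(i,j)\<in>{..n} \<times> {..n}. M * ((1/2) ^ i * (1/2) ^ j))"
      using M by (intro sum_mono2) auto
    also have "\<dots> = M * (\<Sum>(i,j)\<in>{..n} \<times> {..n}. (1/2) ^ i * (1/2) ^ j)"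
      by (simp only: sum_distrib_left case_prod_unfold)
    also have "\<dots> = M * ((\<Sum>i\<le>n. (1/2) ^ i) * (\<Sum>j\<le>n. (1/2) ^ j))"
      by (simp only: sum_product sum.cartesian_product)
    also have "\<dots> \<le> M * (2 * 2)"
      using M geo by (intro mult_left_mono mult_mono) (auto intro: sum_nonneg)
    finally show ?thesis by simp
  qed
  then show ?thesis using B M by (intro that[of "1 / (2 * B)" "M * 4"]) auto
qed

text \<open>Shrinking the radius by s gains s to the power of the weight. For \<open>k\<close>,
  whose weights are at least e + 1, the gain beats the factor \<open>t ^ e\<close> that the shift
  costs.\<close>

lemma trunc_norm_scale:
  assumes "0 \<le> T" "0 \<le> s" "s \<le> 1" and F: "\<And>i j. wt e i j < d \<Longrightarrow> F $ j $ i = 0"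
  shows "trunc_norm e (T * s) n F \<le> s ^ d * trunc_norm e T n F"
  unfolding trunc_norm_def sum_distrib_left
proof (intro sum_mono, clarify)
  fix i j
  show "norm (F $ j $ i) * (T * s) ^ wt e i j \<le> s ^ d * (norm (F $ j $ i) * T ^ wt e i j)"
  proof (cases "wt e i j < d")
    case False
    then have "s ^ wt e i j \<le> s ^ d" using assms by (intro power_decreasing) auto
    then have "(norm (F $ j $ i) * T ^ wt e i j) * s ^ wt e i j \<le> (norm (F $ j $ i) * T ^ wt e i j) * s ^ d"
      using assms by (intro mult_left_mono) auto
    then show ?thesis by (simp only: power_mult_distrib mult_ac)
  qed (use F in simp)
qed

lemma trunc_norm_diff_le: "t \<ge> 0 \<Longrightarrow> trunc_norm e t n (F - G) \<le> trunc_norm e t n F + trunc_norm e t n G"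
  unfolding trunc_norm_def sum.distrib[symmetric]
  by (intro sum_mono) (auto simp flip: distrib_right intro!: mult_right_mono norm_triangle_ineq4)

text \<open>For small t the norm of \<open>k\<close> is at most half of
  \<open>norm c * t ^ e\<close>, so in the equation for \<open>q\<close> the contribution of
  \<open>q * k\<close> is absorbed by the left-hand side. This bounds the norm of \<open>q\<close>
  uniformly in the cut-off, hence its coefficients geometrically.\<close>

lemma convergent_weierstrass_quotient:
  assumes c: "c \<noteq> 0" and k: "\<And>i j. wt e i j \<le> e \<Longrightarrow> k $ j $ i = 0"
    and g: "convergent_fps2 g" and kc: "convergent_fps2 k"
    and q: "fps_const (fps_const c) * q = fps_shift e (g - q * k)"
  shows "convergent_fps2 q"
proof -
  obtain T1 K where K: "0 < T1" "T1 \<le> 1" "0 \<le> K" "\<And>n. trunc_norm e T1 n k \<le> K"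
    using trunc_norm_bounded[OF kc] by metis
  obtain T2 L where L: "0 < T2" "T2 \<le> 1" "0 \<le> L" "\<And>n. trunc_norm e T2 n g \<le> L"
    using trunc_norm_bounded[OF g] by metis
  \<comment> \<open>The first bound keeps t inside the radius T2 that works for \<open>g\<close>;
    the second makes s (K + 1) at most half of \<open>norm c * T1 ^ e\<close>. Using K + 1 avoids
    division by zero.\<close>
  define u where "u = min (T2 / T1) (norm c * T1 ^ e / (2 * (K + 1)))"
  define s where "s = min 1 u"
  define t where "t = T1 * s"
  have s: "0 < s" "s \<le> 1" "s \<le> T2 / T1" "s \<le> norm c * T1 ^ e / (2 * (K + 1))"
    using c K L by (auto simp: s_def u_def)
  have t: "0 < t" "t \<le> 1" "t \<le> T2"
    using s K mult_mono[of T1 1 s 1] by (auto simp: t_def field_simps)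
  have Nk: "trunc_norm e t n k \<le> norm c / 2 * t ^ e" for n
  proof -
    have "trunc_norm e t n k \<le> s ^ Suc e * trunc_norm e T1 n k"
      unfolding t_def using K s k by (intro trunc_norm_scale) auto
    also have "\<dots> \<le> s ^ Suc e * (K + 1)"
      using K s by (intro mult_left_mono order_trans[OF K(4)]) auto
    also have "\<dots> = s ^ e * (s * (K + 1))" by simp
    also have "\<dots> \<le> s ^ e * (norm c * T1 ^ e / 2)"
      using s K by (intro mult_left_mono) (auto simp: field_simps)
    also have "\<dots> = norm c / 2 * t ^ e" by (simp add: t_def power_mult_distrib)
    finally show ?thesis .
  qed
  have Ng: "trunc_norm e t n g \<le> L" for n
  proof -
    have "trunc_norm e t n g \<le> trunc_norm e T2 n g"
      unfolding trunc_norm_def using t by (intro sum_mono) (auto intro!: mult_left_mono power_mono)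
    then show ?thesis using L(4)[of n] by linarith
  qed
  define A where "A = 2 * L / (norm c * t ^ e)"
  have Nq: "trunc_norm e t n q \<le> A" for n
  proof -
    have "norm c * trunc_norm e t n q = trunc_norm e t n (fps_const (fps_const c) * q)"
      by (simp add: trunc_norm_def sum_distrib_left norm_mult case_prod_unfold mult_ac)
    also have "\<dots> = trunc_norm e t n (fps_shift e g - fps_shift e (q * k))"
      unfolding q fps_shift_diff ..
    also have "\<dots> \<le> trunc_norm e t n (fps_shift e g) + trunc_norm e t n (fps_shift e (q * k))"
      using t by (intro trunc_norm_diff_le) simp
    finally have "norm c * trunc_norm e t n q * t ^ e
        \<le> (trunc_norm e t n (fps_shift e g) + trunc_norm e t n (fps_shift e (q * k))) * t ^ e"
      using t by (intro mult_right_mono) auto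
    also have "\<dots> \<le> trunc_norm e t (n + e) g + trunc_norm e t n q * trunc_norm e t (n + e) k"
      unfolding distrib_right by (intro add_mono trunc_norm_shift_le trunc_norm_shift_mult_le t k)
    also have "\<dots> \<le> L + trunc_norm e t n q * (norm c / 2 * t ^ e)"
      using t trunc_norm_nonneg[of t] by (intro add_mono Ng mult_left_mono Nk) auto
    finally have "trunc_norm e t n q * (norm c * t ^ e) \<le> 2 * L"
      by (simp add: algebra_simps)
    moreover have "norm c * t ^ e > 0" using c t by simp
    ultimately show ?thesis unfolding A_def by (simp only: pos_le_divide_eq)
  qed
  have A: "A \<ge> 0" using c t L by (simp add: A_def)
  show ?thesis
  proof (rule convergent_fps2I)
    fix i j
    have "norm (q $ j $ i) * t ^ wt e i j \<le> trunc_norm e t (wt e i j) q"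
      unfolding trunc_norm_def
      using member_le_sum[of "(i,j)" "{(i',j'). wt e i' j' \<le> wt e i j}" "\<lambda>(i,j). norm (q $ j $ i) * t ^ wt e i j"] t
      by auto
    also have "\<dots> \<le> A" by (rule Nq)
    finally have "norm (q $ j $ i) \<le> A * (1 / t) ^ wt e i j"
      using t by (simp add: field_simps power_divide)
    also have "\<dots> \<le> A * (1 / t) ^ (Suc e * (i + j))"
      using t A by (intro mult_left_mono power_increasing) auto
    finally show "norm (q $ j $ i) \<le> A * ((1 / t) ^ Suc e) ^ (i + j)"
      by (simp only: power_mult)
    show "1 \<le> (1 / t) ^ Suc e" using t by (intro one_le_power) auto
  qed
qed

text \<open>The remainder is g - q h. The equation solved by q says precisely that shifting this
  series down by \<open>e\<close> in y gives zero, so no term of y-degree e or more is left.\<close>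

theorem weierstrass_division:
  assumes he: "cf h 0 e \<noteq> 0" and hlow: "\<And>j. j < e \<Longrightarrow> cf h 0 j = 0"
  obtains q r where "g = q * h + r" "\<And>i j. e \<le> j \<Longrightarrow> cf r i j = 0"
proof -
  define c where "c = cf h 0 e"
  define k where "k = fps2_of h - fps_const (fps_const c) * fps_X ^ e"
  have k0: "k $ j $ i = 0" if "wt e i j \<le> e" for i j
  proof -
    have "i = 0" "j \<le> e" using that by (cases i; simp)+
    then show ?thesis using hlow[of j] by (auto simp: k_def c_def cf_def)
  qed
  have kc: "convergent_fps2 k"
  proof -
    have "convergent_fps2 (- (fps_const (fps_const c) * fps_X ^ e))"
      by (rule convergent_fps2_finite_support[of e]) auto
    then show ?thesis
      using convergent_fps2_add[of "fps2_of h" "- (fps_const (fps_const c) * fps_X ^ e)"] fps2_of[of h]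
      by (simp add: k_def)
  qed
  obtain q where q: "fps_const (fps_const c) * q = fps_shift e (fps2_of g - q * k)"
    using formal_weierstrass_quotient[OF he k0] unfolding c_def by blast
  have "convergent_fps2 q"
    using convergent_weierstrass_quotient[OF _ k0 _ kc q] he fps2_of[of g] by (simp add: c_def)
  then obtain q' where q': "fps2_of q' = q" by (metis Conv_series_inverse mem_Collect_eq)
  have "cf (g - q' * h) i j = 0" if "e \<le> j" for i j
  proof -
    have "fps2_of (g - q' * h) = fps2_of g - q * fps2_of h"
      unfolding q'[symmetric] by transfer simp
    also have "\<dots> = fps2_of g - q * k - fps_const (fps_const c) * q * fps_X ^ e"
      by (simp add: k_def algebra_simps)
    finally have "fps_shift e (fps2_of (g - q' * h)) = 0"
      by (simp add: fps_shift_diff q)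
    then have "fps_shift e (fps2_of (g - q' * h)) $ (j - e) = 0" by simp
    then show ?thesis using that by (simp add: cf_def)
  qed
  then show ?thesis by (intro that[of q' "g - q' * h"]) auto
qed


section \<open>Divisibility in the ring of convergent power series\<close>

text \<open>A series with nonzero constant term is a divisor of order e = 0, and then the remainder
  in dividing 1 by it has no terms at all.\<close>

lemma is_unit_iff: "is_unit h \<longleftrightarrow> cf h 0 0 \<noteq> 0"
proof
  assume "is_unit h"
  then obtain g where "1 = h * g" by (rule dvdE)
  then have "cf h 0 0 * cf g 0 0 = 1" using cf_mult[of h g 0 0] by simp
  then show "cf h 0 0 \<noteq> 0" by auto
next
  assume "cf h 0 0 \<noteq> 0"
  then obtain q r where "1 = q * h + r" "\<And>i j. 0 \<le> j \<Longrightarrow> cf r i j = 0"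
    by (rule weierstrass_division[where g = 1]) auto
  moreover from this(2) have "r = 0" by (intro conv_series_eqI) simp
  ultimately show "is_unit h" by (metis add.right_neutral dvd_triv_right)
qed

section \<open>Restriction to the line x = 0\<close>

definition red :: "conv_series \<Rightarrow> complex fps" where
  "red F = Abs_fps (cf F 0)"

lemma red_nth [simp]: "red F $ j = cf F 0 j"
  by (simp add: red_def)

lemma red_mult: "red (F * G) = red F * red G"
  by (rule fps_ext) (simp add: fps_mult_nth cf_mult)

lemma red_eq_0_iff: "red F = 0 \<longleftrightarrow> cs_X dvd F"
  by (simp add: fps_eq_iff cs_X_dvd_iff)

text \<open>The multiples of x form the kernel of \<open>red\<close>, a multiplicative map into an
  integral domain, so x is prime.\<close>

lemma cs_X_dvd_mult_iff: "cs_X dvd a * b \<longleftrightarrow> cs_X dvd a \<or> cs_X dvd b"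
  by (simp flip: red_eq_0_iff add: red_mult)

lemma cs_X_dvd_power_iff: "cs_X dvd a ^ n \<longleftrightarrow> n > 0 \<and> cs_X dvd a"
  by (induction n) (auto simp: cs_X_dvd_mult_iff cs_X_not_unit)

lemma cs_X_power_decompose:
  assumes "h \<noteq> 0"
  obtains k h1 where "h = cs_X ^ k * h1" "\<not> cs_X dvd h1"
proof -
  obtain i j where "cf h i j \<noteq> 0" using assms conv_series_eqI[of h 0] by auto
  then have "\<not> cs_X ^ Suc i dvd h" by (auto simp: cs_X_power_dvd_iff simp del: power_Suc)
  moreover have "cs_X ^ n dvd h" if "\<And>k. cs_X ^ k dvd h \<Longrightarrow> cs_X ^ Suc k dvd h" for n
    by (induction n) (use that in auto)
  ultimately obtain k where k: "cs_X ^ k dvd h" "\<not> cs_X ^ Suc k dvd h" by blast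
  from k(1) obtain h1 where h1: "h = cs_X ^ k * h1" by (rule dvdE)
  have "\<not> cs_X dvd h1" using k(2) by (auto simp: h1)
  with h1 show ?thesis by (rule that)
qed

lemma weierstrass_division':
  assumes "\<not> cs_X dvd h"
  obtains q r where "g = q * h + r" "\<And>i j. subdegree (red h) \<le> j \<Longrightarrow> cf r i j = 0"
proof -
  have ne: "red h \<noteq> 0" using assms by (simp add: red_eq_0_iff)
  have "cf h 0 (subdegree (red h)) \<noteq> 0" using ne nth_subdegree_nonzero by fastforce
  moreover have "cf h 0 j = 0" if "j < subdegree (red h)" for j
    using nth_less_subdegree_zero[OF that] by simp
  ultimately show ?thesis using that by (rule weierstrass_division)
qed

text \<open>On x = 0 this is divisibility of series in y, decided by their orders. Weierstrass
  division supplies a convergent quotient: the remainder has no terms of high y-degree, and on x = 0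
  none of low y-degree either, because g and q h have none there.\<close>

lemma cs_X_dvd_division:
  assumes "\<not> cs_X dvd h" and g: "\<And>j. j < subdegree (red h) \<Longrightarrow> cf g 0 j = 0"
  obtains q where "cs_X dvd g - q * h"
proof -
  obtain q r where qr: "g = q * h + r" "\<And>i j. subdegree (red h) \<le> j \<Longrightarrow> cf r i j = 0"
    using weierstrass_division'[OF assms(1)] by metis
  have "cf r 0 j = 0" for j
  proof (cases "j < subdegree (red h)")
    case True
    have "red (q * h) $ j = 0"
    proof (cases "red (q * h) = 0")
      case False
      then have "subdegree (red h) \<le> subdegree (red (q * h))" by (auto simp: red_mult)
      then show ?thesis using True by (intro nth_less_subdegree_zero) simp
    qed simp
    then show ?thesis using g[OF True] by (simp add: qr(1))
  qed (use qr in simp)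
  then show ?thesis using that[of q] by (simp add: qr(1) cs_X_dvd_iff)
qed

section \<open>Saturated ideals and ideals without common divisors\<close>

interpretation ideals: Modules.module "(*) :: conv_series \<Rightarrow> conv_series \<Rightarrow> conv_series"
  by standard (auto simp: algebra_simps)

declare ideals.scale_scale [simp del]

lemma saturated_ideal_power:
  assumes "\<And>h. cs_X * h \<in> I \<Longrightarrow> h \<in> I" and "cs_X ^ k * h \<in> I"
  shows "h \<in> I"
  using assms(2) by (induction k) (auto intro: assms(1) simp: mult.assoc)

text \<open>The generator h is an element not divisible by x whose restriction to x = 0 has least
  order e. A nonzero remainder of division by h lies in the ideal; after cancelling its powers of x
  it is not divisible by x but still has no terms of y-degree e or more, which contradicts
  minimality.\<close>

lemma saturated_ideal_principal:
  assumes I: "ideals.subspace I" and sat: "\<And>h. cs_X * h \<in> I \<Longrightarrow> h \<in> I"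
  obtains h where "h \<in> I" "\<And>g. g \<in> I \<Longrightarrow> h dvd g"
proof (cases "I = {0}")
  case False
  then obtain g0 where g0: "g0 \<in> I" "g0 \<noteq> 0" using ideals.subspace_0[OF I] by blast
  define P where "P h \<longleftrightarrow> h \<in> I \<and> \<not> cs_X dvd h" for h
  have red: "\<exists>k h. P h \<and> g = cs_X ^ k * h" if "g \<in> I" "g \<noteq> 0" for g
    using cs_X_power_decompose[OF that(2)] saturated_ideal_power[of I, OF sat] that(1) unfolding P_def by metis
  obtain h1 where "P h1" using red[OF g0] by blast
  then obtain h where h: "P h" and min: "\<And>h'. P h' \<Longrightarrow> subdegree (red h) \<le> subdegree (red h')"
    using ex_has_least_nat[of P h1 "\<lambda>h. subdegree (red h)"] by blast
  show ?thesis
  proof (rule that)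
    show "h \<in> I" using h by (simp add: P_def)
    fix g assume g: "g \<in> I"
    obtain q r where qr: "g = q * h + r" "\<And>i j. subdegree (red h) \<le> j \<Longrightarrow> cf r i j = 0"
      using weierstrass_division'[of h] h unfolding P_def by metis
    have "r = 0"
    proof (rule ccontr)
      assume "r \<noteq> 0"
      have "r = g - q * h" by (simp add: qr)
      then have "r \<in> I" using g h I by (auto simp: P_def intro: ideals.subspace_diff ideals.subspace_scale)
      then obtain k r1 where r1: "P r1" "r = cs_X ^ k * r1" using red \<open>r \<noteq> 0\<close> by blast
      have shift: "cf (cs_X ^ k * F) (i + k) j = cf F i j" for F i j
        by (induction k arbitrary: F) (auto simp: mult.assoc)
      have "cf r1 0 (subdegree (red r1)) \<noteq> 0"
        using r1 nth_subdegree_nonzero[of "red r1"] by (auto simp: P_def red_eq_0_iff)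
      moreover have "cf r1 0 (subdegree (red r1)) = 0"
        using qr(2)[OF min[OF r1(1)], of "0 + k"] by (simp only: r1(2) shift)
      ultimately show False by simp
    qed
    then show "h dvd g" by (simp add: qr)
  qed
qed (use that in auto)

definition no_common_divisor :: "conv_series set \<Rightarrow> bool" where
  "no_common_divisor I \<longleftrightarrow> (\<forall>d. (\<forall>a\<in>I. d dvd a) \<longrightarrow> is_unit d)"

text \<open>The saturation I' with respect to x is principal. Its generator divides every element of
  I, hence is a unit, and some power of x times this unit lies in I.\<close>

lemma ideal_contains_cs_X_power:
  assumes I: "ideals.subspace I" and nc: "no_common_divisor I"
  obtains N where "cs_X ^ N \<in> I"
proof -
  define I' where "I' = {h. \<exists>N. cs_X ^ N * h \<in> I}"
  have mono: "cs_X ^ (M + N) * h \<in> I" if "cs_X ^ N * h \<in> I" for M N h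
    using ideals.subspace_scale[OF I that, of "cs_X ^ M"] by (simp add: power_add mult.assoc)
  have "ideals.subspace I'"
  proof (rule ideals.subspaceI)
    show "0 \<in> I'" using ideals.subspace_0[OF I] by (simp add: I'_def)
  next
    fix a b assume "a \<in> I'" "b \<in> I'"
    then obtain M N where "cs_X ^ M * a \<in> I" "cs_X ^ N * b \<in> I" by (auto simp: I'_def)
    then have "cs_X ^ (M + N) * a + cs_X ^ (M + N) * b \<in> I"
      using mono[of M a N] mono[of N b M] by (intro ideals.subspace_add[OF I]) (auto simp: add.commute)
    then show "a + b \<in> I'" by (auto simp: I'_def simp flip: distrib_left)
  next
    fix c a assume "a \<in> I'"
    then obtain M where "cs_X ^ M * a \<in> I" by (auto simp: I'_def)
    from ideals.subspace_scale[OF I this, of c] show "c * a \<in> I'"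
      by (auto simp: I'_def mult.left_commute intro!: exI[of _ M])
  qed
  moreover have "h \<in> I'" if "cs_X * h \<in> I'" for h
  proof -
    obtain N where "cs_X ^ N * (cs_X * h) \<in> I" using \<open>cs_X * h \<in> I'\<close> by (auto simp: I'_def)
    then have "cs_X ^ Suc N * h \<in> I" by (simp only: power_Suc2 mult.assoc)
    then show ?thesis unfolding I'_def by blast
  qed
  ultimately obtain d where d: "d \<in> I'" "\<And>g. g \<in> I' \<Longrightarrow> d dvd g"
    using saturated_ideal_principal[of I'] by blast
  have "a \<in> I'" if "a \<in> I" for a using that unfolding I'_def by (auto intro!: exI[of _ 0])
  then have "is_unit d" using d nc unfolding no_common_divisor_def by blast
  then obtain u where u: "1 = d * u" by (rule dvdE)
  from d(1) obtain N where N: "cs_X ^ N * d \<in> I" by (auto simp: I'_def)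
  have "u * (cs_X ^ N * d) = cs_X ^ N * (d * u)" by (simp only: mult_ac)
  then have "cs_X ^ N \<in> I" using ideals.subspace_scale[OF I N, of u] by (simp only: u[symmetric] mult_1_right)
  then show ?thesis by (rule that)
qed

lemma ideal_not_cs_X_dvd:
  assumes "no_common_divisor I"
  obtains h where "h \<in> I" "\<not> cs_X dvd h"
  using assms cs_X_not_unit unfolding no_common_divisor_def by blast

lemma cf_cs_Y_power [simp]: "cf (cs_Y ^ n) i j = (if i = 0 \<and> j = n then 1 else 0)"
  by (induction n arbitrary: j) auto

text \<open>Modulo an element h of I that x does not divide, a power of y is congruent to x s for
  some s. Its N-th power is then congruent to a multiple of \<open>cs_X ^ N\<close>, which lies in
  I.\<close>

lemma ideal_contains_cs_Y_power:
  assumes I: "ideals.subspace I" and nc: "no_common_divisor I"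
  obtains M where "cs_Y ^ M \<in> I"
proof -
  obtain N where N: "cs_X ^ N \<in> I" using ideal_contains_cs_X_power[OF assms] .
  obtain h where h: "h \<in> I" "\<not> cs_X dvd h" using ideal_not_cs_X_dvd[OF nc] .
  define e where "e = subdegree (red h)"
  obtain q where "cs_X dvd cs_Y ^ e - q * h"
    using cs_X_dvd_division[OF h(2), of "cs_Y ^ e"] e_def by auto
  then obtain s where s: "cs_Y ^ e = q * h + cs_X * s" by (auto elim!: dvdE simp: diff_eq_eq add.commute)
  have "\<exists>a. (q * h + cs_X * s) ^ n = a * h + cs_X ^ n * s ^ n" for n
  proof (induction n)
    case (Suc n)
    then obtain a where "(q * h + cs_X * s) ^ n = a * h + cs_X ^ n * s ^ n" by blast
    then have "(q * h + cs_X * s) ^ Suc n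
        = (q * (a * h + cs_X ^ n * s ^ n) + cs_X * s * a) * h + cs_X ^ Suc n * s ^ Suc n"
      by (simp add: algebra_simps)
    then show ?case by blast
  qed (auto intro: exI[of _ 0])
  then obtain a where "(cs_Y ^ e) ^ N = a * h + s ^ N * cs_X ^ N" unfolding s by (auto simp: mult.commute)
  also have "\<dots> \<in> I" using I N h by (auto intro: ideals.subspace_add ideals.subspace_scale)
  finally show ?thesis using that[of "e * N"] by (simp add: power_mult)
qed

lemma cf_sum: "cf (sum F A) i j = (\<Sum>x\<in>A. cf (F x) i j)"
  by (induction A rule: infinite_finite_induct) auto

lemma cf_monomial: "cf (cs_X ^ a * cs_Y ^ b) i j = (if i = a \<and> j = b then 1 else 0)"
  by (induction a arbitrary: i) (auto simp: mult.assoc)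

text \<open>Division by h removes all y-degrees from e on, and \<open>cs_X ^ N\<close> removes all
  x-degrees from N on. The finitely many remaining monomials span the quotient.\<close>

lemma ideal_finite_codim:
  assumes I: "ideals.subspace I" and nc: "no_common_divisor I"
  obtains B where "finite B" "\<And>F. \<exists>c. F - (\<Sum>b\<in>B. cs_const (c b) * b) \<in> I"
proof -
  obtain N where N: "cs_X ^ N \<in> I" using ideal_contains_cs_X_power[OF assms] .
  obtain h where h: "h \<in> I" "\<not> cs_X dvd h" using ideal_not_cs_X_dvd[OF nc] .
  define e where "e = subdegree (red h)"
  define m where "m = (\<lambda>(a,b). cs_X ^ a * cs_Y ^ b)"
  have inj: "inj_on m A" for A
  proof (rule inj_onI)
    fix x y assume "m x = m y"
    then have "cf (m x) (fst x) (snd x) = cf (m y) (fst x) (snd x)" by simp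
    then show "x = y" by (auto simp: m_def cf_monomial case_prod_unfold prod_eq_iff split: if_splits)
  qed
  have "\<exists>c. F - (\<Sum>b\<in>m ` ({..<N} \<times> {..<e}). cs_const (c b) * b) \<in> I" for F
  proof -
    obtain q r where qr: "F = q * h + r" "\<And>i j. e \<le> j \<Longrightarrow> cf r i j = 0"
      using weierstrass_division'[OF h(2), of F] unfolding e_def by blast
    \<comment> \<open>The spanning set consists of monomials, so the coefficient belonging to
      \<open>b\<close> is found by recovering its exponents through the injective map
      \<open>m\<close>.\<close>
    define c where "c b = (case inv_into UNIV m b of (i,j) \<Rightarrow> cf r i j)" for b
    define s where "s = (\<Sum>b\<in>m ` ({..<N} \<times> {..<e}). cs_const (c b) * b)"
    have s_eq: "s = (\<Sum>(a,b)\<in>{..<N} \<times> {..<e}. cs_const (cf r a b) * (cs_X ^ a * cs_Y ^ b))"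
      unfolding s_def using inj by (subst sum.reindex) (auto simp: c_def m_def intro!: sum.cong)
    have "cf s i j = (if i < N \<and> j < e then cf r i j else 0)" for i j
    proof -
      have "cf s i j = (\<Sum>p\<in>{..<N} \<times> {..<e}. if p = (i,j) then cf r i j else 0)"
        unfolding s_eq cf_sum by (intro sum.cong) (auto simp: cf_monomial split: if_splits)
      also have "\<dots> = (if i < N \<and> j < e then cf r i j else 0)" by (subst sum.delta) auto
      finally show ?thesis .
    qed
    then have "cs_X ^ N dvd r - s" unfolding cs_X_power_dvd_iff using qr(2) by auto
    then obtain t where t: "r - s = cs_X ^ N * t" by (rule dvdE)
    have "F - s = q * h + t * cs_X ^ N" using t by (simp add: qr(1) algebra_simps)
    also have "\<dots> \<in> I" using I N h by (auto intro: ideals.subspace_add ideals.subspace_scale)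
    finally show ?thesis unfolding s_def by blast
  qed
  then show ?thesis by (intro that[of "m ` ({..<N} \<times> {..<e})"]) auto
qed

section \<open>Euclid's lemma\<close>

lemma coprime_cs_X_iff: "coprime a cs_X \<longleftrightarrow> \<not> cs_X dvd a"
proof
  assume "coprime a cs_X"
  then show "\<not> cs_X dvd a" using cs_X_not_unit by (metis coprime_common_divisor dvd_refl)
next
  assume a: "\<not> cs_X dvd a"
  show "coprime a cs_X"
  proof (rule coprimeI)
    fix d assume d: "d dvd a" "d dvd cs_X"
    then obtain k where k: "cs_X = d * k" by blast
    then have "cs_X dvd d \<or> cs_X dvd k" by (simp flip: cs_X_dvd_mult_iff)
    moreover have "\<not> cs_X dvd d" using a d(1) dvd_trans by blast
    ultimately obtain l where "k = cs_X * l" by blast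
    then have "cs_X * (d * l) = cs_X * 1" using k by (simp add: mult_ac)
    then have "d * l = 1" by (simp only: mult_cancel_left cs_X_nonzero) simp
    then show "is_unit d" by (metis dvd_triv_left)
  qed
qed

lemma cs_X_power_dvd_mult_cancel: "\<not> cs_X dvd g \<Longrightarrow> cs_X ^ k dvd g * h \<Longrightarrow> cs_X ^ k dvd h"
proof (induction k arbitrary: h)
  case (Suc k)
  have "cs_X dvd g * h" using Suc.prems by (metis dvd_mult_left power_Suc)
  then obtain h1 where h1: "h = cs_X * h1" using Suc.prems by (auto simp: cs_X_dvd_mult_iff)
  have eq: "g * h = cs_X * (g * h1)" unfolding h1 by (rule mult.left_commute)
  have "cs_X * cs_X ^ k dvd cs_X * (g * h1)" using Suc.prems(2) unfolding eq power_Suc .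
  then have "cs_X ^ k dvd g * h1" unfolding dvd_mult_cancel_left by simp
  then have "cs_X ^ k dvd h1" by (rule Suc.IH[OF Suc.prems(1)])
  then show ?case unfolding h1 power_Suc by (rule mult_dvd_mono[OF dvd_refl])
qed simp

text \<open>Powers of x are split off first. For the rest f1, the colon ideal (f1 : g) is saturated
  because x is prime and does not divide f1; let d generate it. Writing f1 = d m, the relation
  between g d and f1 shows that m divides g. So m is a common divisor of g and f, hence a unit, and
  f1 itself generates the colon ideal.\<close>

lemma coprime_dvd_mult_cancel:
  fixes g f h :: conv_series
  assumes cop: "coprime g f" and dvd: "f dvd g * h" and f: "f \<noteq> 0"
  shows "f dvd h"
proof -
  obtain k f1 where f1: "f = cs_X ^ k * f1" "\<not> cs_X dvd f1" using cs_X_power_decompose[OF f] .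
  have "cs_X ^ k dvd h"
  proof (cases "k = 0")
    case False
    then have "cs_X dvd f" by (auto simp: f1 cs_X_dvd_power_iff)
    then have "\<not> cs_X dvd g" using cop cs_X_not_unit coprime_common_divisor by blast
    then show ?thesis using dvd_trans[OF _ dvd, of "cs_X ^ k"] by (auto simp: f1(1) intro: cs_X_power_dvd_mult_cancel)
  qed simp
  then obtain h1 where h1: "h = cs_X ^ k * h1" by (rule dvdE)
  have "cs_X ^ k * f1 dvd cs_X ^ k * (g * h1)" using dvd by (simp add: f1 h1 mult_ac)
  then have gh1: "f1 dvd g * h1" by simp
  define I where "I = {t. f1 dvd g * t}"
  have "ideals.subspace I"
    by (rule ideals.subspaceI) (auto simp: I_def distrib_left mult.left_commute)
  moreover have "t \<in> I" if "cs_X * t \<in> I" for t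
  proof -
    obtain s where s: "g * (cs_X * t) = f1 * s" using \<open>cs_X * t \<in> I\<close> unfolding I_def by blast
    then have "cs_X dvd f1 * s" by (metis dvd_triv_left mult.left_commute)
    then obtain s1 where s1: "s = cs_X * s1" using f1 by (auto simp: cs_X_dvd_mult_iff)
    have "cs_X * (g * t) = cs_X * (f1 * s1)" using s by (simp add: s1 mult_ac)
    then have "g * t = f1 * s1" by (simp only: mult_cancel_left cs_X_nonzero) simp
    then show ?thesis by (simp add: I_def)
  qed
  ultimately obtain d where d: "d \<in> I" "\<And>t. t \<in> I \<Longrightarrow> d dvd t"
    using saturated_ideal_principal[of I] by blast
  obtain m where m: "f1 = d * m" using d(2)[of f1] unfolding I_def by auto
  obtain l where l: "g * d = f1 * l" using d(1) unfolding I_def by auto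
  have "d \<noteq> 0" using m f1 by auto
  then have "g = m * l" using l by (simp add: m mult_ac)
  then have "m dvd g" "m dvd f" using m f1 by auto
  then have "is_unit m" using cop coprime_common_divisor by blast
  then have "f1 dvd d" by (simp add: m)
  then have "f1 dvd h1" using d(2)[of h1] gh1 unfolding I_def by (auto intro: dvd_trans)
  then show ?thesis by (simp add: f1 h1 mult_dvd_mono)
qed

section \<open>Order of vanishing\<close>

definition order_ge :: "nat \<Rightarrow> conv_series \<Rightarrow> bool" where
  "order_ge n F \<longleftrightarrow> (\<forall>i j. i + j < n \<longrightarrow> cf F i j = 0)"

lemma order_ge_0 [simp]: "order_ge 0 F"
  by (simp add: order_ge_def)

lemma order_ge_mono: "order_ge n F \<Longrightarrow> m \<le> n \<Longrightarrow> order_ge m F"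
  by (auto simp: order_ge_def)

lemma order_ge_add: "order_ge n F \<Longrightarrow> order_ge n G \<Longrightarrow> order_ge n (F + G)"
  by (simp add: order_ge_def)

lemma order_ge_mult:
  assumes "order_ge m F" "order_ge n G"
  shows "order_ge (m + n) (F * G)"
  unfolding order_ge_def
proof (intro allI impI)
  fix i j assume ij: "i + j < m + n"
  have "cf F a b * cf G (i - a) (j - b) = 0" if "a \<le> i" "b \<le> j" for a b
  proof (cases "a + b < m")
    case False
    then have "(i - a) + (j - b) < n" using ij that by linarith
    then show ?thesis using assms by (simp add: order_ge_def)
  qed (use assms in \<open>simp add: order_ge_def\<close>)
  then show "cf (F * G) i j = 0" unfolding cf_mult by (intro sum.neutral ballI) simp
qed

lemma order_ge_dvd: "order_ge n F \<Longrightarrow> F dvd G \<Longrightarrow> order_ge n G"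
  using order_ge_mult[of n F 0] by auto

lemma order_ge_1_iff: "order_ge (Suc 0) F \<longleftrightarrow> \<not> is_unit F"
  by (auto simp: order_ge_def is_unit_iff)

text \<open>The order of vanishing at the origin, meaningful for nonzero series.\<close>

definition order_at0 :: "conv_series \<Rightarrow> nat" where
  "order_at0 F = (LEAST n. \<not> order_ge (Suc n) F)"

lemma order_ge_iff:
  assumes "F \<noteq> 0"
  shows "order_ge n F \<longleftrightarrow> n \<le> order_at0 F"
proof -
  obtain i j where "cf F i j \<noteq> 0" using assms conv_series_eqI[of F 0] by auto
  then have "\<not> order_ge (Suc (i + j)) F" by (auto simp: order_ge_def)
  then have 1: "\<not> order_ge (Suc (order_at0 F)) F" unfolding order_at0_def by (rule LeastI)
  have 2: "order_ge (order_at0 F) F"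
  proof (cases "order_at0 F")
    case (Suc m)
    then show ?thesis using not_less_Least[of m "\<lambda>n. \<not> order_ge (Suc n) F"] by (simp add: order_at0_def)
  qed simp
  show ?thesis using 1 2 order_ge_mono[of _ F] by (meson not_less_eq_eq)
qed

text \<open>In characteristic zero a series of order n > 0 has a partial derivative of order n - 1,
  which is not divisible by a series of order n.\<close>

lemma deriv_divisible_imp_unit:
  assumes "d \<noteq> 0" "d dvd deriv_x d" "d dvd deriv_y d"
  shows "is_unit d"
proof (rule ccontr)
  assume nu: "\<not> is_unit d"
  define n where "n = order_at0 d"
  have n: "order_ge n d" "\<not> order_ge (Suc n) d" "n > 0"
    using nu order_ge_iff[OF assms(1)] order_ge_1_iff[of d] by (auto simp: n_def Suc_le_eq)
  then have x: "order_ge n (deriv_x d)" and y: "order_ge n (deriv_y d)"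
    using assms order_ge_dvd by blast+
  obtain i j where ij: "i + j = n" "cf d i j \<noteq> 0"
    using n(1,2) unfolding order_ge_def by (metis less_antisym)
  show False
  proof (cases i)
    case 0
    then obtain j' where "j = Suc j'" using ij n(3) by (cases j) auto
    then show False using y[unfolded order_ge_def, rule_format, of 0 j'] ij 0 by (simp del: of_nat_Suc)
  next
    case (Suc i')
    then show False using x[unfolded order_ge_def, rule_format, of i' j] ij by (simp del: of_nat_Suc)
  qed
qed

text \<open>A non-unit common divisor d of least order plays the part of a prime factor. With f = d
  k, minimality and squarefreeness make k and d coprime. The product rule shows that d divides k
  times each partial derivative of d, and Euclid's lemma cancels k.\<close>

lemma squarefree_no_common_divisor:
  assumes sqf: "squarefree f" and d: "d dvd f" "d dvd deriv_x f" "d dvd deriv_y f"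
  shows "is_unit d"
proof (rule ccontr)
  define P where "P d \<longleftrightarrow> \<not> is_unit d \<and> d dvd f \<and> d dvd deriv_x f \<and> d dvd deriv_y f" for d
  assume "\<not> is_unit d"
  then have "P d" using d by (simp add: P_def)
  then obtain d where d: "P d" and min: "\<And>c. P c \<Longrightarrow> order_at0 d \<le> order_at0 c"
    using ex_has_least_nat[of P d order_at0] by blast
  have f: "f \<noteq> 0" using sqf by auto
  obtain k where k: "f = d * k" using d unfolding P_def by blast
  have d0: "d \<noteq> 0" using f k by auto
  have cop: "coprime k d"
  proof (rule coprimeI)
    fix c assume c: "c dvd k" "c dvd d"
    show "is_unit c"
    proof (rule ccontr)
      assume nu: "\<not> is_unit c"
      then have Pc: "P c" using d c unfolding P_def by (meson dvd_trans)
      obtain m where m: "d = c * m" using c by blast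
      \<comment> \<open>If d and c are associated, d divides k and its square divides f. Otherwise c
        has smaller order than d.\<close>
      show False
      proof (cases "is_unit m")
        case True
        then have "d dvd k" using c by (simp add: m mult_unit_dvd_iff)
        then have "d ^ 2 dvd f" by (auto simp: k power2_eq_square)
        then show False using sqf d unfolding squarefree_def P_def by blast
      next
        case False
        have "c \<noteq> 0" using d0 m by auto
        then have "order_ge (order_at0 c) c" using order_ge_iff by blast
        then have "order_ge (order_at0 c + Suc 0) d"
          unfolding m using False by (intro order_ge_mult) (auto simp: order_ge_1_iff)
        then show False using min[OF Pc] order_ge_iff[OF d0] by simp
      qed
    qed
  qed
  have "d dvd k * deriv_x d" "d dvd k * deriv_y d"
    using d unfolding P_def k deriv_x_mult deriv_y_mult
    by (auto simp: mult.commute[of k] dvd_add_left_iff)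
  then have "d dvd deriv_x d" "d dvd deriv_y d"
    using coprime_dvd_mult_cancel[OF cop _ d0] by blast+
  then have "is_unit d" by (rule deriv_divisible_imp_unit[OF d0])
  then show False using d by (simp add: P_def)
qed


section \<open>The Saito module\<close>

declare forms.scale_scale [simp del]

text \<open>The coefficient of dx \<and> dy in the exterior product.\<close>

definition wedge :: "form1 \<Rightarrow> form1 \<Rightarrow> conv_series" where
  "wedge v w = fst v * snd w - snd v * fst w"

lemma fst_form_scale [simp]: "fst (form_scale p w) = p * fst w"
  and snd_form_scale [simp]: "snd (form_scale p w) = p * snd w"
  by (auto simp: form_scale_def)

lemma wedge_linear_left:
  "wedge 0 w = 0" "wedge (u + v) w = wedge u w + wedge v w" "wedge (form_scale p v) w = p * wedge v w"
  by (auto simp: wedge_def algebra_simps)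

lemma wedge_linear_right:
  "wedge w 0 = 0" "wedge w (u + v) = wedge w u + wedge w v" "wedge w (form_scale p v) = p * wedge w v"
  by (auto simp: wedge_def algebra_simps)

lemma wedge_self [simp]: "wedge v v = 0"
  by (simp add: wedge_def)

lemma forms_span_pair: "v \<in> forms.span {a, b} \<longleftrightarrow> (\<exists>p q. v = form_scale p a + form_scale q b)"
  by (auto simp: forms.span_breakdown_eq diff_eq_eq algebra_simps)

lemma ideals_span_pair: "v \<in> ideals.span {a, b} \<longleftrightarrow> (\<exists>p q. v = p * a + q * b)"
  by (auto simp: ideals.span_breakdown_eq diff_eq_eq algebra_simps)

section \<open>The Tjurina ideal and the wedge criterion\<close>

definition tjurina_ideal :: "conv_series \<Rightarrow> conv_series set" where
  "tjurina_ideal f = ideals.span {f, deriv_x f, deriv_y f}"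

definition jacobian_ideal :: "conv_series \<Rightarrow> conv_series set" where
  "jacobian_ideal f = ideals.span {deriv_x f, deriv_y f}"

lemma tjurina_ideal_subspace: "ideals.subspace (tjurina_ideal f)"
  by (simp add: tjurina_ideal_def)

lemma tjurina_ideal_gens: "f \<in> tjurina_ideal f" "deriv_x f \<in> tjurina_ideal f" "deriv_y f \<in> tjurina_ideal f"
  by (auto simp: tjurina_ideal_def intro: ideals.span_base)

lemma tjurina_ideal_no_common_divisor:
  "squarefree f \<Longrightarrow> no_common_divisor (tjurina_ideal f)"
  using squarefree_no_common_divisor tjurina_ideal_gens unfolding no_common_divisor_def by blast

text \<open>With f1 the part of f prime to x and h in the ideal not divisible by x, take a power of
  x plus f1 h. A common divisor with f is not divisible by x, so it divides f1, then the power of x,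
  and is a unit.\<close>

lemma exists_coprime_in_tjurina_ideal:
  assumes sqf: "squarefree f"
  obtains g where "g \<in> tjurina_ideal f" "coprime g f"
proof -
  note I = tjurina_ideal_subspace[of f] and nc = tjurina_ideal_no_common_divisor[OF sqf]
  have f: "f \<noteq> 0" using sqf by auto
  obtain N where N: "cs_X ^ N \<in> tjurina_ideal f" using ideal_contains_cs_X_power[OF I nc] .
  obtain h where h: "h \<in> tjurina_ideal f" "\<not> cs_X dvd h" using ideal_not_cs_X_dvd[OF nc] .
  obtain k f1 where f1: "f = cs_X ^ k * f1" "\<not> cs_X dvd f1" using cs_X_power_decompose[OF f] .
  \<comment> \<open>The extra factor \<open>cs_X\<close> keeps the exponent positive even for N =
    0.\<close>
  define g where "g = cs_X * cs_X ^ N + f1 * h"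
  have "g \<in> tjurina_ideal f" unfolding g_def
    using N h by (intro ideals.subspace_add[OF I] ideals.subspace_scale[OF I])
  moreover have "coprime g f"
  proof (rule coprimeI)
    fix d assume d: "d dvd g" "d dvd f"
    have nX: "\<not> cs_X dvd d"
    proof
      assume "cs_X dvd d"
      then have "cs_X dvd g" using d(1) dvd_trans by blast
      then have "cs_X dvd f1 * h" unfolding g_def by (simp add: dvd_add_right_iff)
      then show False using f1 h by (simp add: cs_X_dvd_mult_iff)
    qed
    then have cop: "coprime cs_X d" using coprime_cs_X_iff coprime_commute by blast
    have d0: "d \<noteq> 0" using d(2) f by auto
    have cancel: "d dvd cs_X ^ n * b \<Longrightarrow> d dvd b" for n b
      by (induction n) (auto simp: mult.assoc intro: coprime_dvd_mult_cancel[OF cop _ d0])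
    have "d dvd f1" using cancel d(2) unfolding f1(1) by blast
    then have "d dvd cs_X ^ Suc N * 1" using d(1) unfolding g_def by (simp add: dvd_add_left_iff)
    then show "is_unit d" by (rule cancel)
  qed
  ultimately show ?thesis by (rule that)
qed

lemma F_module_dvd_wedge:
  assumes "\<omega> \<in> F_module f"
  shows "f dvd wedge \<omega> (differential f)"
  using assms unfolding F_module_def by (auto simp: wedge_linear_left)

text \<open>For \<omega> = A dx + B dy with A f_y - B f_x = f h, one has f_x \<omega> = A df - f h
  dy and f_y \<omega> = B df + f h dx.\<close>

lemma tjurina_ideal_scale_in_F_module:
  assumes w: "f dvd wedge \<omega> (differential f)" and g: "g \<in> tjurina_ideal f"
  shows "form_scale g \<omega> \<in> F_module f"
proof -
  obtain h where h: "wedge \<omega> (differential f) = f * h" using w by (rule dvdE)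
  define A where "A = fst \<omega>"
  define B where "B = snd \<omega>"
  have eq: "A * deriv_y f - B * deriv_x f = f * h" and \<omega>: "\<omega> = (A, B)"
    using h by (auto simp: A_def B_def wedge_def differential_def)
  have "form_scale (deriv_x f) \<omega> = form_scale A (differential f) + form_scale f (0, - h)"
    using eq by (simp add: \<omega> form_scale_def differential_def algebra_simps)
  then have x: "form_scale (deriv_x f) \<omega> \<in> F_module f" unfolding F_module_def by blast
  have "form_scale (deriv_y f) \<omega> = form_scale B (differential f) + form_scale f (h, 0)"
    using eq by (simp add: \<omega> form_scale_def differential_def algebra_simps)
  then have y: "form_scale (deriv_y f) \<omega> \<in> F_module f" unfolding F_module_def by blast
  have "form_scale f \<omega> = form_scale 0 (differential f) + form_scale f \<omega>" by simp
  then have z: "form_scale f \<omega> \<in> F_module f" unfolding F_module_def by blast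
  have "ideals.subspace {g. form_scale g \<omega> \<in> F_module f}"
    using forms.subspace_0[OF subspace_F_module] forms.subspace_add[OF subspace_F_module]
      forms.subspace_scale[OF subspace_F_module]
    by (intro ideals.subspaceI) (auto simp: forms.scale_left_distrib simp flip: forms.scale_scale)
  then have "tjurina_ideal f \<subseteq> {g. form_scale g \<omega> \<in> F_module f}"
    unfolding tjurina_ideal_def using x y z by (intro ideals.span_minimal) auto
  then show ?thesis using g by blast
qed

lemma saito_module_iff:
  assumes sqf: "squarefree f"
  shows "\<omega> \<in> saito_module f \<longleftrightarrow> f dvd wedge \<omega> (differential f)"
proof
  assume "\<omega> \<in> saito_module f"
  then obtain g where g: "coprime g f" "form_scale g \<omega> \<in> F_module f" unfolding saito_module_def by blast
  then have "f dvd g * wedge \<omega> (differential f)"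
    using F_module_dvd_wedge[OF g(2)] by (simp only: wedge_linear_left)
  moreover have "f \<noteq> 0" using sqf by auto
  ultimately show "f dvd wedge \<omega> (differential f)" by (rule coprime_dvd_mult_cancel[OF g(1)])
next
  assume w: "f dvd wedge \<omega> (differential f)"
  obtain g where "g \<in> tjurina_ideal f" "coprime g f" using exists_coprime_in_tjurina_ideal[OF sqf] .
  then show "\<omega> \<in> saito_module f"
    using tjurina_ideal_scale_in_F_module[OF w] unfolding saito_module_def by blast
qed

lemma F_module_subset_saito_module: "F_module f \<subseteq> saito_module f"
  unfolding saito_module_def by (auto intro: exI[of _ 1])

lemma saito_module_subspace: "squarefree f \<Longrightarrow> forms.subspace (saito_module f)"
  by (rule forms.subspaceI) (auto simp: saito_module_iff wedge_linear_left)

text \<open>After multiplication by g and g' both forms lie in F(f), where wedge products are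
  multiples of f because df \<and> df = 0. Euclid's lemma cancels g and g'.\<close>

lemma saito_module_wedge_dvd:
  assumes f: "f \<noteq> 0" and "\<omega> \<in> saito_module f" "\<omega>' \<in> saito_module f"
  shows "f dvd wedge \<omega> \<omega>'"
proof -
  obtain g p \<eta> where g: "coprime g f" "form_scale g \<omega> = form_scale p (differential f) + form_scale f \<eta>"
    using assms(2) unfolding saito_module_def F_module_def by blast
  obtain g' p' \<eta>' where g': "coprime g' f" "form_scale g' \<omega>' = form_scale p' (differential f) + form_scale f \<eta>'"
    using assms(3) unfolding saito_module_def F_module_def by blast
  have "g * (g' * wedge \<omega> \<omega>') = wedge (form_scale g \<omega>) (form_scale g' \<omega>')"
    by (simp add: wedge_linear_left wedge_linear_right mult_ac)
  also have "\<dots> = f * (p * wedge (differential f) \<eta>' + p' * wedge \<eta> (differential f) + f * wedge \<eta> \<eta>')"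
    unfolding g g' by (simp add: wedge_linear_left wedge_linear_right algebra_simps)
  finally have "f dvd g * (g' * wedge \<omega> \<omega>')" by simp
  then show ?thesis using coprime_dvd_mult_cancel[OF _ _ f] g(1) g'(1) by blast
qed

lemma saito_module_elems:
  assumes "squarefree f"
  shows "differential f \<in> saito_module f" "(f, 0) \<in> saito_module f" "(0, f) \<in> saito_module f"
  by (auto simp: saito_module_iff[OF assms] wedge_def)

text \<open>By Cramer's rule, with integral coefficients because \<open>f\<close> divides \<open>\<omega> \<and> \<omega>'\<close>.\<close>

lemma saito_module_generated:
  assumes sqf: "squarefree f" and \<omega>: "wedge \<omega> (differential f) = f" and \<omega>': "\<omega>' \<in> saito_module f"
  shows "\<exists>p q. \<omega>' = form_scale p \<omega> + form_scale q (differential f)"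
proof -
  have f: "f \<noteq> 0" using sqf by auto
  have "\<omega> \<in> saito_module f" using \<omega> by (simp add: saito_module_iff[OF sqf])
  then have "f dvd wedge \<omega> \<omega>'" by (rule saito_module_wedge_dvd[OF f _ \<omega>'])
  then obtain q where q: "wedge \<omega> \<omega>' = f * q" by (rule dvdE)
  have "f dvd wedge \<omega>' (differential f)" using \<omega>' by (simp add: saito_module_iff[OF sqf])
  then obtain p where p: "wedge \<omega>' (differential f) = f * p" by (rule dvdE)
  define df where "df = differential f"
  have "f * fst \<omega>' = f * (p * fst \<omega> + q * fst df)" "f * snd \<omega>' = f * (p * snd \<omega> + q * snd df)"
  proof -
    have "wedge \<omega> df * fst \<omega>' = wedge \<omega>' df * fst \<omega> + wedge \<omega> \<omega>' * fst df"
      "wedge \<omega> df * snd \<omega>' = wedge \<omega>' df * snd \<omega> + wedge \<omega> \<omega>' * snd df"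
      by (auto simp: wedge_def algebra_simps)
    then show "f * fst \<omega>' = f * (p * fst \<omega> + q * fst df)" "f * snd \<omega>' = f * (p * snd \<omega> + q * snd df)"
      using p q \<omega> by (auto simp: df_def algebra_simps)
  qed
  then have "\<omega>' = form_scale p \<omega> + form_scale q df"
    using f by (simp add: prod_eq_iff)
  then show ?thesis unfolding df_def by blast
qed

text \<open>All wedge products of elements of S(f) are multiples of \<omega> \<and> df = f h. For
  the pairs formed from f dx, f dy and df these products are, up to sign, f times f, f_y and f_x, so
  h is a common divisor of f, f_x, f_y and hence a unit.\<close>

lemma saito_basis_imp_jacobian:
  assumes sqf: "squarefree f" and basis: "saito_basis f {\<omega>, differential f}" and \<omega>: "\<omega> \<in> saito_module f"
  shows "f \<in> jacobian_ideal f"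
proof -
  have f: "f \<noteq> 0" using sqf by auto
  have gen: "\<exists>p q. v = form_scale p \<omega> + form_scale q (differential f)" if "v \<in> saito_module f" for v
    using that basis by (auto simp: saito_basis_def simp flip: forms_span_pair)
  obtain h where h: "wedge \<omega> (differential f) = f * h"
    using \<omega> saito_module_iff[OF sqf] unfolding dvd_def by blast
  have dvd: "f * h dvd wedge u v" if mem: "u \<in> saito_module f" "v \<in> saito_module f" for u v
  proof -
    obtain p q p' q' where uv: "u = form_scale p \<omega> + form_scale q (differential f)"
      "v = form_scale p' \<omega> + form_scale q' (differential f)"
      using gen[OF mem(1)] gen[OF mem(2)] by blast
    have "wedge u v = (p * q' - q * p') * wedge \<omega> (differential f)"
      by (simp add: uv wedge_def algebra_simps)
    then show ?thesis by (simp add: h)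
  qed
  have "f * h dvd f * f" "f * h dvd f * deriv_y f" "f * h dvd f * deriv_x f"
    using dvd[OF saito_module_elems(2,3)[OF sqf]] dvd[OF saito_module_elems(2,1)[OF sqf]]
      dvd[OF saito_module_elems(1,3)[OF sqf]]
    by (simp_all add: wedge_def differential_def mult.commute)
  then have "is_unit h" using squarefree_no_common_divisor[OF sqf, of h] f by simp
  then obtain u where u: "1 = h * u" by (rule dvdE)
  have "f = u * wedge \<omega> (differential f)" using u h by (simp add: mult_ac)
  also have "\<dots> = (- u * snd \<omega>) * deriv_x f + (u * fst \<omega>) * deriv_y f"
    by (simp add: wedge_def differential_def algebra_simps)
  finally show ?thesis unfolding jacobian_ideal_def ideals_span_pair by blast
qed

lemma jacobian_imp_wedge:
  assumes "f \<in> jacobian_ideal f"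
  obtains \<omega> where "wedge \<omega> (differential f) = f"
proof -
  obtain p q where "f = p * deriv_x f + q * deriv_y f"
    using assms unfolding jacobian_ideal_def ideals_span_pair by blast
  then have "wedge (q, - p) (differential f) = f" by (simp add: wedge_def differential_def add.commute)
  then show ?thesis by (rule that)
qed

text \<open>Wedging a linear relation with df and with \<omega> isolates its two coefficients;
  generation is Cramer's rule.\<close>

lemma wedge_imp_saito_basis:
  assumes sqf: "squarefree f" and \<omega>: "wedge \<omega> (differential f) = f"
  shows "saito_basis f {\<omega>, differential f}"
  unfolding saito_basis_def
proof (intro conjI)
  have f: "f \<noteq> 0" using sqf by auto
  have ne: "\<omega> \<noteq> differential f" using \<omega> f by auto
  show "card {\<omega>, differential f} = 2" using ne by simp
  have "p = 0 \<and> q = 0" if "form_scale p \<omega> + form_scale q (differential f) = 0" for p q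
  proof -
    have "wedge (form_scale p \<omega> + form_scale q (differential f)) (differential f) = p * f"
      "wedge \<omega> (form_scale p \<omega> + form_scale q (differential f)) = q * f"
      using \<omega> by (simp_all add: wedge_linear_left wedge_linear_right)
    then show ?thesis using f unfolding that by (simp add: wedge_linear_left wedge_linear_right)
  qed
  then show "forms.independent {\<omega>, differential f}"
    using ne by (subst forms.dependent_finite) auto
  have "\<omega> \<in> saito_module f" using \<omega> by (simp add: saito_module_iff[OF sqf])
  then have "forms.span {\<omega>, differential f} \<subseteq> saito_module f"
    using saito_module_elems(1)[OF sqf] by (intro forms.span_minimal saito_module_subspace sqf) auto
  then show "forms.span {\<omega>, differential f} = saito_module f"
    using saito_module_generated[OF sqf \<omega>] by (auto simp: forms_span_pair)
qed

lemma saito_basis_iff_jacobian: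
  assumes sqf: "squarefree f"
  shows "(\<exists>\<omega>\<in>saito_module f. saito_basis f {\<omega>, differential f}) \<longleftrightarrow> f \<in> jacobian_ideal f"
proof
  assume "f \<in> jacobian_ideal f"
  then obtain \<omega> where "wedge \<omega> (differential f) = f" by (rule jacobian_imp_wedge)
  then show "\<exists>\<omega>\<in>saito_module f. saito_basis f {\<omega>, differential f}"
    using wedge_imp_saito_basis[OF sqf] saito_module_iff[OF sqf] by (metis dvd_refl)
qed (use saito_basis_imp_jacobian[OF sqf] in blast)


section \<open>The torsion module\<close>

lemma form_eq_cs_X_scale:
  assumes "cs_X dvd fst v" "cs_X dvd snd v"
  obtains w where "v = form_scale cs_X w"
proof -
  obtain a b where "fst v = cs_X * a" "snd v = cs_X * b" using assms by (auto elim!: dvdE)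
  then have "v = form_scale cs_X (a, b)" by (simp add: prod_eq_iff)
  then show ?thesis by (rule that)
qed

text \<open>Modulo x the values of \<open>Z\<close> are series in y, and one of least order divides
  all the others. If all values vanish modulo x, v = 0 will do. Linearity is asked for on S only, so
  that \<open>Z\<close> may be defined by a description that makes sense just there.\<close>

lemma linear_minimal_element:
  assumes S: "forms.subspace S"
    and add: "\<And>u v. u \<in> S \<Longrightarrow> v \<in> S \<Longrightarrow> Z (u - v) = Z u - Z v"
    and scale: "\<And>p u. u \<in> S \<Longrightarrow> Z (form_scale p u) = p * Z u"
  obtains v where "v \<in> S" "\<And>u. u \<in> S \<Longrightarrow> \<exists>p. cs_X dvd Z (u - form_scale p v)"
proof (cases "\<exists>v\<in>S. \<not> cs_X dvd Z v")
  case True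
  define P where "P v \<longleftrightarrow> v \<in> S \<and> \<not> cs_X dvd Z v" for v
  obtain v0 where "P v0" using True by (auto simp: P_def)
  then obtain v where v: "P v" and min: "\<And>u. P u \<Longrightarrow> subdegree (red (Z v)) \<le> subdegree (red (Z u))"
    using ex_has_least_nat[of P v0 "\<lambda>v. subdegree (red (Z v))"] by blast
  show ?thesis
  proof (rule that)
    show "v \<in> S" using v by (simp add: P_def)
    fix u assume u: "u \<in> S"
    have "cf (Z u) 0 j = 0" if "j < subdegree (red (Z v))" for j
    proof (cases "cs_X dvd Z u")
      case False
      then have "j < subdegree (red (Z u))" using min[of u] u that by (simp add: P_def)
      from nth_less_subdegree_zero[OF this] show ?thesis by simp
    qed (simp add: cs_X_dvd_iff)
    then obtain q where "cs_X dvd Z u - q * Z v"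
      using cs_X_dvd_division[of "Z v" "Z u"] v unfolding P_def by metis
    then show "\<exists>p. cs_X dvd Z (u - form_scale p v)"
      using u v S by (auto simp: P_def add scale forms.subspace_scale)
  qed
next
  case False
  then show ?thesis using that[of 0] forms.subspace_0[OF S] by auto
qed

text \<open>First v1 clears the dx-component modulo x, then v2, taken among the elements where this
  component is already divisible by x, clears \<open>Z\<close>. By \<open>div\<close> what is left
  is x times an element of S.\<close>

lemma two_generators_mod_cs_X:
  assumes S: "forms.subspace S"
    and add: "\<And>u v. u \<in> S \<Longrightarrow> v \<in> S \<Longrightarrow> Z (u - v) = Z u - Z v"
    and scale: "\<And>p u. u \<in> S \<Longrightarrow> Z (form_scale p u) = p * Z u"
    and div: "\<And>u. u \<in> S \<Longrightarrow> cs_X dvd fst u \<Longrightarrow> cs_X dvd Z u \<Longrightarrow> \<exists>w\<in>S. u = form_scale cs_X w"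
  obtains v1 v2 where "v1 \<in> S" "v2 \<in> S"
    "\<And>u. u \<in> S \<Longrightarrow> \<exists>a\<in>forms.span {v1, v2}. \<exists>w\<in>S. u = a + form_scale cs_X w"
proof -
  obtain v1 where v1: "v1 \<in> S" "\<And>u. u \<in> S \<Longrightarrow> \<exists>p. cs_X dvd fst (u - form_scale p v1)"
    using linear_minimal_element[OF S, of fst] by auto
  define S' where "S' = {u \<in> S. cs_X dvd fst u}"
  have S': "forms.subspace S'"
    using S by (auto simp: S'_def forms.subspace_def)
  obtain v2 where v2: "v2 \<in> S'" "\<And>u. u \<in> S' \<Longrightarrow> \<exists>p. cs_X dvd Z (u - form_scale p v2)"
    using linear_minimal_element[OF S', of Z] add scale unfolding S'_def by auto
  have "\<exists>a\<in>forms.span {v1, v2}. \<exists>w\<in>S. u = a + form_scale cs_X w" if u: "u \<in> S" for u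
  proof -
    obtain p where "cs_X dvd fst (u - form_scale p v1)" using v1(2)[OF u] by blast
    then have u': "u - form_scale p v1 \<in> S'"
      using S u v1(1) unfolding S'_def by (auto intro: forms.subspace_diff forms.subspace_scale)
    then obtain q where q: "cs_X dvd Z (u - form_scale p v1 - form_scale q v2)" using v2(2) by blast
    have u'': "u - form_scale p v1 - form_scale q v2 \<in> S'"
      using u' v2(1) S' by (auto intro: forms.subspace_diff forms.subspace_scale)
    then obtain w where w: "w \<in> S" "u - form_scale p v1 - form_scale q v2 = form_scale cs_X w"
      using div q unfolding S'_def by blast
    then have "u = (form_scale p v1 + form_scale q v2) + form_scale cs_X w" by (simp add: algebra_simps)
    then show ?thesis using w(1) forms_span_pair by blast
  qed
  then show ?thesis using that v1(1) v2(1) unfolding S'_def by blast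
qed

text \<open>The surplus generators are removed one at a time. Writing g = a + x w and expanding w,
  which involves g with some coefficient k, puts (1 - x k) g into the span of the others, and 1 - x
  k is a unit.\<close>

lemma nakayama:
  assumes "finite G" and "S \<subseteq> forms.span (V \<union> G)" "G \<subseteq> S"
    and mod: "\<And>u. u \<in> S \<Longrightarrow> \<exists>a\<in>forms.span V. \<exists>w\<in>S. u = a + form_scale cs_X w"
  shows "S \<subseteq> forms.span V"
  using assms(1-3)
proof (induction G)
  case (insert g G)
  obtain a w where aw: "a \<in> forms.span V" "w \<in> S" "g = a + form_scale cs_X w"
    using mod[of g] insert.prems by blast
  have "w \<in> forms.span (insert g (V \<union> G))" using aw(2) insert.prems(1) by auto
  then obtain k where k: "w - form_scale k g \<in> forms.span (V \<union> G)"
    unfolding forms.span_breakdown_eq by blast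
  have a: "a \<in> forms.span (V \<union> G)" using aw(1) forms.span_mono[of V "V \<union> G"] by blast
  have "form_scale (1 - cs_X * k) g = a + form_scale cs_X (w - form_scale k g)"
    by (subst (1) aw(3)) (simp add: aw(3) algebra_simps forms.scale_scale)
  also have "\<dots> \<in> forms.span (V \<union> G)" by (intro forms.span_add forms.span_scale a k)
  finally have g: "form_scale (1 - cs_X * k) g \<in> forms.span (V \<union> G)" .
  have "is_unit (1 - cs_X * k)" by (simp add: is_unit_iff)
  then obtain u where u: "1 = (1 - cs_X * k) * u" by (rule dvdE)
  have "form_scale u (form_scale (1 - cs_X * k) g) = g"
    using u by (simp add: forms.scale_scale mult.commute)
  then have "g \<in> forms.span (V \<union> G)" using forms.span_scale[OF g, of u] by simp
  then have "V \<union> insert g G \<subseteq> forms.span (V \<union> G)" using forms.span_superset[of "V \<union> G"] by auto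
  then have "forms.span (V \<union> insert g G) \<subseteq> forms.span (V \<union> G)" by (rule forms.span_minimal) simp
  then show ?case using insert by auto
qed simp

section \<open>Derivations preserving the Tjurina ideal\<close>

lemma deriv_cs_X_power:
  "deriv_x (cs_X ^ Suc n) = cs_const (of_nat (Suc n)) * cs_X ^ n" "deriv_y (cs_X ^ n) = 0"
proof -
  have cf: "cf (cs_X ^ n) i j = (if i = n \<and> j = 0 then 1 else 0)" for n i j
    using cf_monomial[of n 0 i j] by simp
  show "deriv_x (cs_X ^ Suc n) = cs_const (of_nat (Suc n)) * cs_X ^ n" "deriv_y (cs_X ^ n) = 0"
    by (auto intro!: conv_series_eqI simp: cf simp del: power_Suc of_nat_Suc)
qed

lemma deriv_cs_Y_power:
  "deriv_y (cs_Y ^ Suc n) = cs_const (of_nat (Suc n)) * cs_Y ^ n" "deriv_x (cs_Y ^ n) = 0"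
  by (auto intro!: conv_series_eqI simp del: power_Suc of_nat_Suc)

text \<open>
  A form \<open>A dx + B dy\<close> in the Saito module gives the derivation \<open>D = A \<partial>\<^sub>y - B \<partial>\<^sub>x\<close>, which maps the
  Tjurina ideal to itself. The ideal is primary to the maximal ideal; if \<open>A\<close> were a unit, applying
  \<open>D\<close> to the least power of \<open>y\<close> in the ideal would produce a smaller one.
\<close>

lemma saito_module_derivation:
  assumes \<omega>: "f dvd wedge \<omega> (differential f)" and g: "g \<in> tjurina_ideal f"
  shows "fst \<omega> * deriv_y g - snd \<omega> * deriv_x g \<in> tjurina_ideal f"
proof -
  note I = tjurina_ideal_subspace[of f]
  define D where "D g = fst \<omega> * deriv_y g - snd \<omega> * deriv_x g" for g
  define T where "T = {g \<in> tjurina_ideal f. D g \<in> tjurina_ideal f}"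
  have D_add: "D (a + b) = D a + D b" and D_mult: "D (a * b) = a * D b + D a * b" for a b
    by (auto simp: D_def deriv_add deriv_x_mult deriv_y_mult algebra_simps)
  have "deriv_x 0 = 0" "deriv_y 0 = 0" by (auto intro!: conv_series_eqI)
  then have "ideals.subspace T"
    using ideals.subspace_0[OF I] ideals.subspace_add[OF I] ideals.subspace_scale[OF I]
    by (intro ideals.subspaceI) (auto simp: T_def D_add D_mult, auto simp: D_def)
  moreover have "{f, deriv_x f, deriv_y f} \<subseteq> T"
  proof -
    obtain h where h: "D f = f * h"
      using \<omega> by (auto simp: D_def wedge_def differential_def elim: dvdE)
    \<comment> \<open>Commuting D with a partial derivative costs only multiples of f_x and f_y, and
      the derivatives of D f = f h lie in the ideal.\<close>
    have "D (deriv_x f) = deriv_x (D f) - deriv_x (fst \<omega>) * deriv_y f + deriv_x (snd \<omega>) * deriv_x f"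
      "D (deriv_y f) = deriv_y (D f) - deriv_y (fst \<omega>) * deriv_y f + deriv_y (snd \<omega>) * deriv_x f"
    proof -
      have minus: "deriv_x (a - b) = deriv_x a - deriv_x b" "deriv_y (a - b) = deriv_y a - deriv_y b" for a b
        by (auto intro!: conv_series_eqI simp: algebra_simps)
      show "D (deriv_x f) = deriv_x (D f) - deriv_x (fst \<omega>) * deriv_y f + deriv_x (snd \<omega>) * deriv_x f"
        "D (deriv_y f) = deriv_y (D f) - deriv_y (fst \<omega>) * deriv_y f + deriv_y (snd \<omega>) * deriv_x f"
        by (auto simp: D_def minus deriv_x_mult deriv_y_mult deriv_commute algebra_simps)
    qed
    then have eq: "D f = h * f"
      "D (deriv_x f) = h * deriv_x f + deriv_x h * f - deriv_x (fst \<omega>) * deriv_y f + deriv_x (snd \<omega>) * deriv_x f"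
      "D (deriv_y f) = h * deriv_y f + deriv_y h * f - deriv_y (fst \<omega>) * deriv_y f + deriv_y (snd \<omega>) * deriv_x f"
      by (simp_all add: h deriv_x_mult deriv_y_mult algebra_simps)
    have "D f \<in> tjurina_ideal f" "D (deriv_x f) \<in> tjurina_ideal f" "D (deriv_y f) \<in> tjurina_ideal f"
      unfolding eq by (intro ideals.subspace_add[OF I] ideals.subspace_diff[OF I] ideals.subspace_scale[OF I] tjurina_ideal_gens)+
    then show ?thesis using tjurina_ideal_gens by (auto simp: T_def)
  qed
  ultimately have "tjurina_ideal f \<subseteq> T" unfolding tjurina_ideal_def by (intro ideals.span_minimal)
  then show ?thesis using g by (auto simp: T_def D_def)
qed

lemma tjurina_ideal_proper:
  assumes "order_ge 2 f" "g \<in> tjurina_ideal f"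
  shows "\<not> is_unit g"
proof -
  have "ideals.subspace {g. cf g 0 0 = 0}"
    by (rule ideals.subspaceI) (auto simp: cf_mult)
  moreover have "{f, deriv_x f, deriv_y f} \<subseteq> {g. cf g 0 0 = 0}"
    using assms(1) by (auto simp: order_ge_def)
  ultimately have "tjurina_ideal f \<subseteq> {g. cf g 0 0 = 0}"
    unfolding tjurina_ideal_def by (intro ideals.span_minimal)
  then show ?thesis using assms(2) by (auto simp: is_unit_iff)
qed

lemma saito_module_not_unit:
  assumes sqf: "squarefree f" and ord: "order_ge 2 f" and \<omega>: "\<omega> \<in> saito_module f"
  shows "\<not> is_unit (fst \<omega>)" "\<not> is_unit (snd \<omega>)"
proof -
  note I = tjurina_ideal_subspace[of f] and nc = tjurina_ideal_no_common_divisor[OF sqf]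
  have "f dvd wedge \<omega> (differential f)" using \<omega> by (simp add: saito_module_iff[OF sqf])
  note D = saito_module_derivation[OF this]
  \<comment> \<open>Used twice: with P n = \<open>cs_Y ^ n\<close> and u the dx-component, and with
    P n = \<open>cs_X ^ n\<close> and u minus the dy-component. In both cases the derivation sends P
    (n + 1) to u (n + 1) P n.\<close>
  have least: False
    if P: "\<exists>n. P n \<in> tjurina_ideal f" and P0: "P 0 = 1" and u: "is_unit u"
      and step: "\<And>n. P (Suc n) \<in> tjurina_ideal f \<Longrightarrow> u * (cs_const (of_nat (Suc n)) * P n) \<in> tjurina_ideal f" for P u
  proof -
    define n where "n = (LEAST n. P n \<in> tjurina_ideal f)"
    have n: "P n \<in> tjurina_ideal f" unfolding n_def using P by (rule LeastI_ex)
    show False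
    proof (cases n)
      case 0
      then show False using n P0 tjurina_ideal_proper[OF ord, of 1] by simp
    next
      case (Suc m)
      have "is_unit (u * cs_const (of_nat (Suc m)))"
        using u by (simp add: is_unit_iff cf_mult del: of_nat_Suc)
      then obtain v where v: "1 = (u * cs_const (of_nat (Suc m))) * v" by (rule dvdE)
      have "v * (u * (cs_const (of_nat (Suc m)) * P m)) \<in> tjurina_ideal f"
        by (rule ideals.subspace_scale[OF I step]) (use n Suc in simp)
      also have "v * (u * (cs_const (of_nat (Suc m)) * P m)) = ((u * cs_const (of_nat (Suc m))) * v) * P m"
        by (simp only: mult_ac)
      also have "\<dots> = P m" by (simp only: v[symmetric] mult_1_left)
      finally show False using not_less_Least[of m "\<lambda>n. P n \<in> tjurina_ideal f"] Suc by (simp add: n_def)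
    qed
  qed
  show "\<not> is_unit (fst \<omega>)"
  proof
    assume u: "is_unit (fst \<omega>)"
    show False
    proof (rule least[OF _ _ u])
      show "\<exists>n. cs_Y ^ n \<in> tjurina_ideal f" using ideal_contains_cs_Y_power[OF I nc] by metis
      fix n assume "cs_Y ^ Suc n \<in> tjurina_ideal f"
      from D[OF this] show "fst \<omega> * (cs_const (of_nat (Suc n)) * cs_Y ^ n) \<in> tjurina_ideal f"
        by (simp only: deriv_cs_Y_power mult_zero_right diff_zero)
    qed simp
  qed
  show "\<not> is_unit (snd \<omega>)"
  proof
    assume "is_unit (snd \<omega>)"
    then have u: "is_unit (- snd \<omega>)" by simp
    show False
    proof (rule least[OF _ _ u])
      show "\<exists>n. cs_X ^ n \<in> tjurina_ideal f" using ideal_contains_cs_X_power[OF I nc] by metis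
      fix n assume "cs_X ^ Suc n \<in> tjurina_ideal f"
      from D[OF this] show "- snd \<omega> * (cs_const (of_nat (Suc n)) * cs_X ^ n) \<in> tjurina_ideal f"
        by (simp only: deriv_cs_X_power mult_zero_right diff_0 mult_minus_left)
    qed simp
  qed
qed

text \<open>
  The Saito module is the syzygy module of \<open>f\<^sub>y, -f\<^sub>x, -f\<close>. Over \<open>x = 0\<close> one of the three
  components of a syzygy is determined by the other two: the third one if \<open>x\<close> does not divide \<open>f\<close>,
  and the second one if it does.
\<close>

lemma saito_module_two_generators_mod_cs_X:
  assumes sqf: "squarefree f"
  obtains v1 v2 where "v1 \<in> saito_module f" "v2 \<in> saito_module f"
    "\<And>u. u \<in> saito_module f \<Longrightarrow> \<exists>a\<in>forms.span {v1, v2}. \<exists>w\<in>saito_module f. u = a + form_scale cs_X w"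
proof (cases "cs_X dvd f")
  case False
  have "\<exists>w\<in>saito_module f. u = form_scale cs_X w"
    if u: "u \<in> saito_module f" "cs_X dvd fst u" "cs_X dvd snd u" for u
  proof -
    obtain w where w: "u = form_scale cs_X w" using form_eq_cs_X_scale u(2,3) by blast
    have "f dvd cs_X * wedge w (differential f)"
      using u(1) by (simp add: saito_module_iff[OF sqf] w wedge_linear_left)
    moreover have "coprime cs_X f" using False coprime_cs_X_iff coprime_commute by blast
    moreover have "f \<noteq> 0" using sqf by auto
    ultimately have "f dvd wedge w (differential f)" using coprime_dvd_mult_cancel by blast
    then show ?thesis using w saito_module_iff[OF sqf] by blast
  qed
  then show ?thesis
    using two_generators_mod_cs_X[OF saito_module_subspace[OF sqf], of snd] that by auto
next
  case True
  then obtain f1 where f1: "f = cs_X * f1" by (rule dvdE)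
  have nX: "\<not> cs_X dvd f1"
  proof
    assume "cs_X dvd f1"
    then have "cs_X ^ 2 dvd f" by (auto simp: f1 power2_eq_square)
    then show False using sqf cs_X_not_unit unfolding squarefree_def by blast
  qed
  have f: "f \<noteq> 0" using sqf by auto
  have dX: "deriv_x cs_X = 1" "deriv_y cs_X = 0"
    using deriv_cs_X_power(1)[of 0] deriv_cs_X_power(2)[of 1] by (auto intro!: conv_series_eqI)
  \<comment> \<open>The third component of the syzygy, unique because f is nonzero.\<close>
  define Z where "Z u = (THE h. wedge u (differential f) = f * h)" for u
  have Z_eqI: "Z u = h" if "wedge u (differential f) = f * h" for u h
    unfolding Z_def using that f by auto
  have Z: "wedge u (differential f) = f * Z u" if u: "u \<in> saito_module f" for u
  proof -
    obtain h where "wedge u (differential f) = f * h"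
      using u unfolding saito_module_iff[OF sqf] by (rule dvdE)
    with Z_eqI[OF this] show ?thesis by simp
  qed
  have "\<exists>w\<in>saito_module f. u = form_scale cs_X w"
    if u: "u \<in> saito_module f" "cs_X dvd fst u" "cs_X dvd Z u" for u
  proof -
    obtain z where z: "Z u = cs_X * z" using u(3) by (rule dvdE)
    have df: "deriv_x f = f1 + cs_X * deriv_x f1" "deriv_y f = cs_X * deriv_y f1"
      by (simp_all add: f1 deriv_x_mult deriv_y_mult dX)
    \<comment> \<open>With f = x f1, the derivative f_y is divisible by x and f_x is congruent to
      f1, so modulo x only the term \<open>snd u * f1\<close> survives.\<close>
    have "fst u * (cs_X * deriv_y f1) - snd u * (f1 + cs_X * deriv_x f1) = (cs_X * f1) * Z u"
      using Z[OF u(1)] unfolding wedge_def differential_def fst_conv snd_conv df by (simp flip: f1)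
    then have "snd u * f1 = cs_X * (fst u * deriv_y f1 - snd u * deriv_x f1 - f1 * Z u)"
      by (simp add: algebra_simps)
    then have "cs_X dvd snd u * f1" by simp
    then have "cs_X dvd snd u" using nX by (simp add: cs_X_dvd_mult_iff)
    then obtain w where w: "u = form_scale cs_X w" using form_eq_cs_X_scale u(2) by blast
    have "cs_X * wedge w (differential f) = cs_X * (f * z)"
      using Z[OF u(1)] by (simp add: w wedge_linear_left z[unfolded w] mult_ac)
    then have "wedge w (differential f) = f * z" by (simp only: mult_cancel_left cs_X_nonzero) simp
    then have "w \<in> saito_module f" using saito_module_iff[OF sqf, of w] by simp
    then show ?thesis using w by blast
  qed
  moreover have "Z (u - v) = Z u - Z v" if "u \<in> saito_module f" "v \<in> saito_module f" for u v
    using Z[OF that(1)] Z[OF that(2)] by (intro Z_eqI) (simp add: wedge_def algebra_simps)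
  moreover have "Z (form_scale p u) = p * Z u" if "u \<in> saito_module f" for p u
    using Z[OF that] by (intro Z_eqI) (simp add: wedge_linear_left)
  ultimately show ?thesis
    using two_generators_mod_cs_X[OF saito_module_subspace[OF sqf], of Z] that by blast
qed

text \<open>
  If \<open>\<omega>\<close> generates the torsion module and \<open>\<omega> \<and> df = h f dx \<and> dy\<close> with \<open>h\<close> not a unit, then all
  products \<open>u \<and> v\<close> of elements of the Saito module are non-unit multiples of \<open>f\<close>, so it cannot
  have two generators.
\<close>

lemma cyclic_imp_jacobian:
  assumes sqf: "squarefree f" and ord: "order_ge 2 f"
    and \<omega>: "\<omega> \<in> saito_module f" and gen: "\<And>u. u \<in> saito_module f \<Longrightarrow> \<exists>p. u - form_scale p \<omega> \<in> F_module f"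
  shows "f \<in> jacobian_ideal f"
proof -
  have f: "f \<noteq> 0" using sqf by auto
  define df where "df = differential f"
  define G where "G = {\<omega>, df, (f, 0), (0, f)}"
  note S = saito_module_subspace[OF sqf]
  have GS: "G \<subseteq> saito_module f" using \<omega> saito_module_elems[OF sqf] by (auto simp: G_def df_def)
  have span: "saito_module f \<subseteq> forms.span G"
  proof
    fix u assume "u \<in> saito_module f"
    then obtain p q \<eta> where "u - form_scale p \<omega> = form_scale q df + form_scale f \<eta>"
      using gen unfolding F_module_def df_def by blast
    then have "u = form_scale p \<omega> + (form_scale q df + (form_scale (fst \<eta>) (f, 0) + form_scale (snd \<eta>) (0, f)))"
      by (simp add: diff_eq_eq prod_eq_iff add.commute mult.commute)
    then show "u \<in> forms.span G"
      by (simp only:) (intro forms.span_add forms.span_scale forms.span_base, auto simp: G_def)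
  qed
  obtain h where h: "wedge \<omega> df = f * h"
    using \<omega> unfolding saito_module_iff[OF sqf] df_def by (rule dvdE)
  have "is_unit h"
  proof (rule ccontr)
    assume nu: "\<not> is_unit h"
    obtain v1 v2 where v: "v1 \<in> saito_module f" "v2 \<in> saito_module f"
      and mod: "\<And>u. u \<in> saito_module f \<Longrightarrow> \<exists>a\<in>forms.span {v1, v2}. \<exists>w\<in>saito_module f. u = a + form_scale cs_X w"
      using saito_module_two_generators_mod_cs_X[OF sqf] by blast
    have "saito_module f \<subseteq> forms.span ({v1, v2} \<union> G)" using span forms.span_mono[of G "{v1, v2} \<union> G"] by blast
    moreover have "finite G" by (simp add: G_def)
    ultimately have S2: "saito_module f \<subseteq> forms.span {v1, v2}"
      using nakayama[OF _ _ GS mod] by blast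
    obtain k where k: "wedge v1 v2 = f * k" using saito_module_wedge_dvd[OF f v] by (rule dvdE)
    have dvd: "f * k dvd wedge u v" if mem: "u \<in> saito_module f" "v \<in> saito_module f" for u v
    proof -
      obtain p q p' q' where uv: "u = form_scale p v1 + form_scale q v2"
        "v = form_scale p' v1 + form_scale q' v2"
        using subsetD[OF S2 mem(1)] subsetD[OF S2 mem(2)] unfolding forms_span_pair by blast
      have "wedge u v = (p * q' - q * p') * wedge v1 v2" by (simp add: uv wedge_def algebra_simps)
      then show ?thesis by (simp add: k)
    qed
    \<comment> \<open>Since v1 and v2 generate S(f), k divides f, f_x and f_y, so v1 \<and> v2 is a
      unit times f.\<close>
    have "f * k dvd f * f" "f * k dvd f * deriv_y f" "f * k dvd f * deriv_x f"
      using dvd[OF saito_module_elems(2,3)[OF sqf]] dvd[OF saito_module_elems(2,1)[OF sqf]]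
        dvd[OF saito_module_elems(1,3)[OF sqf]]
      by (simp_all add: wedge_def differential_def mult.commute)
    then have k_unit: "is_unit k" using squarefree_no_common_divisor[OF sqf, of k] f by simp
    \<comment> \<open>The ideal of non-unit multiples of f. It contains all wedge products of the
      four generators: \<omega> \<and> df because h is not a unit, the others because f, f_x, f_y
      and both components of \<omega> vanish at the origin.\<close>
    define M where "M = {a. \<exists>b. a = f * b \<and> cf b 0 0 = 0}"
    have "ideals.subspace M"
    proof (rule ideals.subspaceI)
      show "0 \<in> M" unfolding M_def by (auto intro!: exI[of _ 0])
    next
      fix a b assume "a \<in> M" "b \<in> M"
      then obtain a' b' where "a = f * a'" "b = f * b'" "cf a' 0 0 = 0" "cf b' 0 0 = 0" by (auto simp: M_def)
      then show "a + b \<in> M" unfolding M_def by (auto intro!: exI[of _ "a' + b'"] simp: distrib_left)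
    next
      fix c a assume "a \<in> M"
      then obtain a' where "a = f * a'" "cf a' 0 0 = 0" by (auto simp: M_def)
      then show "c * a \<in> M" unfolding M_def by (auto intro!: exI[of _ "c * a'"] simp: cf_mult)
    qed
    note M = ideals.subspace_0[OF this] ideals.subspace_add[OF this] ideals.subspace_scale[OF this]
    have nz: "cf h 0 0 = 0" "cf (fst \<omega>) 0 0 = 0" "cf (snd \<omega>) 0 0 = 0"
        "cf f 0 0 = 0" "cf (deriv_x f) 0 0 = 0" "cf (deriv_y f) 0 0 = 0"
      using nu saito_module_not_unit[OF sqf ord \<omega>] ord
      by (auto simp: is_unit_iff order_ge_def)
    have MI: "cf b 0 0 = 0 \<Longrightarrow> f * b \<in> M" "cf b 0 0 = 0 \<Longrightarrow> b * f \<in> M"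
      "cf b 0 0 = 0 \<Longrightarrow> - (f * b) \<in> M" "cf b 0 0 = 0 \<Longrightarrow> - (b * f) \<in> M" for b
      unfolding M_def by (auto simp: mult.commute intro: exI[of _ "- b"])
    have wedge_swap: "wedge u v = - wedge v u" for u v by (simp add: wedge_def)
    have "wedge df \<omega> = - (f * h)" using wedge_swap[of df \<omega>] h by simp
    then have GG: "wedge u v \<in> M" if "u \<in> G" "v \<in> G" for u v
      using that h nz M(1) unfolding G_def
      by (auto simp: MI) (auto simp: wedge_def df_def differential_def intro!: MI nz)
    have "wedge u v \<in> M" if u: "u \<in> G" and v: "v \<in> forms.span G" for u v
    proof -
      have "forms.subspace {v. wedge u v \<in> M}"
        by (rule forms.subspaceI) (auto simp: wedge_linear_right M)
      then have "forms.span G \<subseteq> {v. wedge u v \<in> M}"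
        by (intro forms.span_minimal subsetI CollectI GG[OF u])
      then show ?thesis using v by blast
    qed
    moreover have "forms.subspace {u. wedge u v2 \<in> M}"
      by (rule forms.subspaceI) (auto simp: wedge_linear_left M)
    ultimately have "forms.span G \<subseteq> {u. wedge u v2 \<in> M}"
      using v(2) span by (intro forms.span_minimal subsetI CollectI) blast+
    then have "wedge v1 v2 \<in> M" using v span by blast
    then show False using k_unit k f by (auto simp: M_def is_unit_iff)
  qed
  then obtain u where u: "1 = h * u" by (rule dvdE)
  have "f = u * wedge \<omega> df" using u h by (simp add: mult_ac)
  also have "\<dots> = (- u * snd \<omega>) * deriv_x f + (u * fst \<omega>) * deriv_y f"
    by (simp add: wedge_def df_def differential_def algebra_simps)
  finally show ?thesis unfolding jacobian_ideal_def ideals_span_pair by blast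
qed

text \<open>A form with \<omega> \<and> df = f generates S(f) together with df, which is zero in the
  torsion module. If \<omega> were in F(f), cancelling f would give \<eta> \<and> df = 1, but f_x
  and f_y vanish at the origin.\<close>

lemma jacobian_imp_cyclic_nontrivial:
  assumes sqf: "squarefree f" and ord: "order_ge 2 f" and f: "f \<in> jacobian_ideal f"
  shows "\<exists>\<omega>\<in>saito_module f. \<omega> \<notin> F_module f \<and>
    (\<forall>u\<in>saito_module f. \<exists>p. u - form_scale p \<omega> \<in> F_module f)"
proof -
  obtain \<omega> where \<omega>: "wedge \<omega> (differential f) = f" using f by (rule jacobian_imp_wedge)
  have f0: "f \<noteq> 0" using sqf by auto
  show ?thesis
  proof (intro bexI conjI ballI)
    show "\<omega> \<in> saito_module f" using \<omega> by (simp add: saito_module_iff[OF sqf])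
    show "\<omega> \<notin> F_module f"
    proof
      assume "\<omega> \<in> F_module f"
      then obtain p \<eta> where "\<omega> = form_scale p (differential f) + form_scale f \<eta>" unfolding F_module_def by blast
      then have "f * wedge \<eta> (differential f) = f * 1" using \<omega> by (simp add: wedge_linear_left)
      then have "wedge \<eta> (differential f) = 1" using f0 by simp
      then have "cf (wedge \<eta> (differential f)) 0 0 = 1" by simp
      then show False using ord by (simp add: wedge_def differential_def cf_mult order_ge_def)
    qed
    fix u assume "u \<in> saito_module f"
    then obtain p q where "u = form_scale p \<omega> + form_scale q (differential f)"
      using saito_module_generated[OF sqf \<omega>] by blast
    then have "u - form_scale p \<omega> = form_scale q (differential f) + form_scale f 0" by simp
    then show "\<exists>p. u - form_scale p \<omega> \<in> F_module f" unfolding F_module_def by blast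
  qed
qed


section \<open>Multiplicity and quotient dimensions\<close>

lemma CS_simps [simp]:
  "carrier CS = UNIV" "monoid.mult CS = (*)" "ring.add CS = (+)" "ring.zero CS = (0 :: conv_series)"
  "monoid.one CS = (1 :: conv_series)"
  by (auto simp: ring_of_type_algebra_def)

interpretation CS: cring "CS"
  by (rule cring_from_type_algebra)

lemma a_inv_CS [simp]: "a_inv CS (x :: conv_series) = - x"
  by (rule CS.minus_equality) auto

lemma ideal_CS:
  assumes "ideals.subspace I"
  shows "ideal I CS"
proof (rule idealI)
  show "subgroup I (add_monoid CS)"
  proof (rule CS.add.subgroupI)
    show "I \<noteq> {}" using ideals.subspace_0[OF assms] by auto
    show "\<ominus>\<^bsub>CS\<^esub> a \<in> I" if "a \<in> I" for a using ideals.subspace_neg[OF assms that] by simp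
  qed (use ideals.subspace_add[OF assms] in auto)
  show "\<And>a x. a \<in> I \<Longrightarrow> x \<in> carrier CS \<Longrightarrow> x \<otimes>\<^bsub>CS\<^esub> a \<in> I"
    using ideals.subspace_scale[OF assms] by simp
  show "\<And>a x. a \<in> I \<Longrightarrow> x \<in> carrier CS \<Longrightarrow> a \<otimes>\<^bsub>CS\<^esub> x \<in> I"
    using ideals.subspace_scale[OF assms] by (simp add: mult.commute)
qed (rule CS.ring_axioms)

lemma Idl_CS: "Idl\<^bsub>CS\<^esub> S = ideals.span S"
proof
  show "Idl\<^bsub>CS\<^esub> S \<subseteq> ideals.span S"
    by (intro CS.genideal_minimal ideal_CS ideals.subspace_span ideals.span_superset)
  interpret Idl: ideal "Idl\<^bsub>CS\<^esub> S" CS by (rule CS.genideal_ideal) simp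
  have "ideals.subspace (Idl\<^bsub>CS\<^esub> S)"
  proof (rule ideals.subspaceI)
    show "0 \<in> Idl\<^bsub>CS\<^esub> S" using Idl.zero_closed by simp
    show "\<And>x y. x \<in> Idl\<^bsub>CS\<^esub> S \<Longrightarrow> y \<in> Idl\<^bsub>CS\<^esub> S \<Longrightarrow> x + y \<in> Idl\<^bsub>CS\<^esub> S" using Idl.a_closed by simp
    show "\<And>c x. x \<in> Idl\<^bsub>CS\<^esub> S \<Longrightarrow> c * x \<in> Idl\<^bsub>CS\<^esub> S" using Idl.I_l_closed by simp
  qed
  then show "ideals.span S \<subseteq> Idl\<^bsub>CS\<^esub> S"
    using CS.genideal_self[of S] by (intro ideals.span_minimal) auto
qed

section \<open>Powers of the maximal ideal and the multiplicity\<close>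

lemma order_ge_subspace: "ideals.subspace {F. order_ge n F}"
  using order_ge_mult[of 0 _ n] by (intro ideals.subspaceI) (auto simp: order_ge_add, simp add: order_ge_def)

lemma max_ideal_power_ideal: "ideal (max_ideal_power n) CS"
proof (induction n)
  case 0
  show ?case using CS.oneideal by simp
next
  case (Suc n)
  have "ideal (Idl\<^bsub>CS\<^esub> {cs_X, cs_Y}) CS" unfolding Idl_CS by (intro ideal_CS) simp
  then show ?case using Suc CS.ideal_prod_is_ideal by simp
qed

lemma max_ideal_power_antimono: "m \<le> n \<Longrightarrow> max_ideal_power n \<subseteq> max_ideal_power m"
proof (induction rule: dec_induct)
  case (step n)
  have "ideal (Idl\<^bsub>CS\<^esub> {cs_X, cs_Y}) CS" unfolding Idl_CS by (intro ideal_CS) simp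
  from CS.ideal_prod_inter[OF this max_ideal_power_ideal[of n]] step show ?case by auto
qed simp

lemma max_ideal_power_order_ge: "F \<in> max_ideal_power n \<Longrightarrow> order_ge n F"
proof (induction n arbitrary: F)
  case (Suc n)
  have X: "Idl\<^bsub>CS\<^esub> {cs_X, cs_Y} \<subseteq> {F. order_ge 1 F}"
    unfolding Idl_CS using cf_monomial[of 1 0] cf_monomial[of 0 1]
    by (intro ideals.span_minimal order_ge_subspace) (auto simp: order_ge_def)
  from Suc.prems have "F \<in> ideal_prod CS (Idl\<^bsub>CS\<^esub> {cs_X, cs_Y}) (max_ideal_power n)" by simp
  then show ?case
  proof (induction rule: ideal_prod.induct)
    case (prod i j)
    then show ?case using X order_ge_mult[of 1 i n j] Suc.IH by auto
  next
    case (sum s1 s2)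
    then show ?case by (simp add: order_ge_add)
  qed
qed simp

text \<open>The description in \<open>multiplicity0\<close> is well defined: f lies in no power of
  the maximal ideal beyond its order, and the powers decrease, so there is exactly one last power
  containing f.\<close>

lemma order_ge_multiplicity0:
  assumes "f \<noteq> 0"
  shows "order_ge (multiplicity0 f) f"
proof -
  define P where "P m \<longleftrightarrow> f \<in> max_ideal_power m \<and> f \<notin> max_ideal_power (Suc m)" for m
  define m where "m = (LEAST n. f \<notin> max_ideal_power (Suc n))"
  have "f \<notin> max_ideal_power (Suc (order_at0 f))"
    using max_ideal_power_order_ge order_ge_iff[OF assms] by fastforce
  then have "f \<notin> max_ideal_power (Suc m)" unfolding m_def by (rule LeastI)
  moreover have "f \<in> max_ideal_power m"
    using not_less_Least[of _ "\<lambda>n. f \<notin> max_ideal_power (Suc n)"] by (cases m) (auto simp: m_def)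
  ultimately have "P m" by (simp add: P_def)
  moreover have "a = b" if "P a" "P b" for a b
    using that max_ideal_power_antimono[of "Suc a" b] max_ideal_power_antimono[of "Suc b" a]
    unfolding P_def by (metis in_mono linorder_neqE_nat Suc_leI)
  ultimately have "P (multiplicity0 f)" unfolding multiplicity0_def P_def[symmetric] by (metis theI)
  then show ?thesis using max_ideal_power_order_ge by (simp add: P_def)
qed

section \<open>Dimensions of quotient rings\<close>

abbreviation coset :: "conv_series set \<Rightarrow> conv_series \<Rightarrow> conv_series set" where
  "coset I a \<equiv> I +>\<^bsub>CS\<^esub> a"

lemma coset_eq_zero_iff:
  assumes "ideals.subspace I"
  shows "coset I a = \<zero>\<^bsub>CS Quot I\<^esub> \<longleftrightarrow> a \<in> I"
proof -
  have c: "coset I a = {h + a | h. h \<in> I}" by (auto simp: a_r_coset_def r_coset_def)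
  have z: "\<zero>\<^bsub>CS Quot I\<^esub> = I" by (simp add: FactRing_def)
  show ?thesis unfolding z
  proof
    assume "coset I a = I"
    then show "a \<in> I" using ideals.subspace_0[OF assms] unfolding c by force
  next
    assume a: "a \<in> I"
    show "coset I a = I"
    proof (intro equalityI subsetI)
      fix x assume "x \<in> I"
      then have "x = (x - a) + a" "x - a \<in> I" using ideals.subspace_diff[OF assms _ a] by auto
      then show "x \<in> coset I a" unfolding c by blast
    qed (use ideals.subspace_add[OF assms _ a] in \<open>auto simp: c\<close>)
  qed
qed

abbreviation constants :: "conv_series set" where
  "constants \<equiv> range cs_const"

lemma cs_const_simps:
  "cs_const (a * b) = cs_const a * cs_const b" "cs_const (a + b) = cs_const a + cs_const b"
  "cs_const (- a) = - cs_const a" "cs_const 1 = 1" "cs_const 0 = 0"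
  by (auto intro!: conv_series_eqI)

lemma cs_const_inverse: "z \<noteq> 0 \<Longrightarrow> cs_const (inverse z) * cs_const z = 1"
  by (simp add: cs_const_simps flip: cs_const_simps(1))

lemma subfield_constants: "subfield constants CS"
proof (rule CS.subfieldI)
  show "subcring constants CS"
  proof (intro CS.subcringI' CS.subringI)
    show "\<one>\<^bsub>CS\<^esub> \<in> constants" using cs_const_simps(4) by (metis CS_simps(5) rangeI)
  qed (auto simp flip: cs_const_simps)
  have inv: "\<exists>b. cs_const a * cs_const b = 1" if "cs_const a \<noteq> 0" for a
  proof -
    have "a \<noteq> 0" using that cs_const_simps(5) by auto
    then show ?thesis using cs_const_inverse[of a] by (auto simp: mult.commute)
  qed
  show "Units (CS\<lparr>carrier := constants\<rparr>) = constants - {\<zero>\<^bsub>CS\<^esub>}"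
    using inv by (auto simp: Units_def mult.commute)
qed

lemma quotient_hom:
  assumes I: "ideals.subspace I" "1 \<notin> I"
  shows "ring_hom_ring CS (CS Quot I) (coset I)"
    and "\<one>\<^bsub>CS Quot I\<^esub> \<noteq> \<zero>\<^bsub>CS Quot I\<^esub>"
    and "subfield (coset I ` constants) (CS Quot I)"
proof -
  show hom: "ring_hom_ring CS (CS Quot I) (coset I)"
    by (rule ideal.rcos_ring_hom_ring[OF ideal_CS[OF I(1)]])
  have "coset I 1 = \<one>\<^bsub>CS Quot I\<^esub>" by (simp add: FactRing_def)
  then show ne: "\<one>\<^bsub>CS Quot I\<^esub> \<noteq> \<zero>\<^bsub>CS Quot I\<^esub>"
    using coset_eq_zero_iff[OF I(1), of 1] I(2) by simp
  show "subfield (coset I ` constants) (CS Quot I)"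
    by (rule ring_hom_ring.img_is_subfield(2)[OF hom subfield_constants ne])
qed

lemma carrier_quotient: "carrier (CS Quot I) = range (coset I)"
  by (auto simp: FactRing_def A_RCOSETS_def' a_r_coset_def)

text \<open>The quotient map carries the span over the constants of a finite spanning list modulo I
  onto the whole quotient.\<close>

lemma quotient_finite_dimension:
  assumes I: "ideals.subspace I" "1 \<notin> I" and nc: "no_common_divisor I"
  shows "ring.finite_dimension (CS Quot I) (coset I ` constants) (carrier (CS Quot I))"
proof -
  interpret hom: ring_hom_ring CS "CS Quot I" "coset I" by (rule quotient_hom[OF I])
  obtain B where B: "finite B" "\<And>F. \<exists>c. F - (\<Sum>b\<in>B. cs_const (c b) * b) \<in> I"
    using ideal_finite_codim[OF I(1) nc] by blast
  obtain bs where bs: "set bs = B" using finite_list[OF B(1)] by blast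
  have sum_in: "(\<Sum>b\<in>A. cs_const (c b) * b) \<in> CS.Span constants bs" if "finite A" "A \<subseteq> B" for A c
    using that
  proof (induction A)
    case empty
    then show ?case using CS.Span_subgroup_props(2)[OF subfield_constants, of bs] by simp
  next
    case (insert a A)
    have "a \<in> CS.Span constants bs"
      using CS.Span_base_incl[OF subfield_constants, of bs] insert bs by auto
    then have "cs_const (c a) * a \<in> CS.Span constants bs"
      using CS.Span_smult_closed[OF subfield_constants, of bs "cs_const (c a)" a] by simp
    then show ?case
      using insert CS.Span_subgroup_props(3)[OF subfield_constants, of bs] by simp
  qed
  have "carrier (CS Quot I) \<subseteq> coset I ` CS.Span constants bs"
  proof
    fix x assume "x \<in> carrier (CS Quot I)"
    then obtain F where x: "x = coset I F" unfolding carrier_quotient by auto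
    obtain c where c: "F - (\<Sum>b\<in>B. cs_const (c b) * b) \<in> I" using B(2) by blast
    define s where "s = (\<Sum>b\<in>B. cs_const (c b) * b)"
    have "coset I F = coset I ((F - s) \<oplus>\<^bsub>CS\<^esub> s)" by simp
    also have "\<dots> = coset I (F - s) \<oplus>\<^bsub>CS Quot I\<^esub> coset I s" by (rule hom.hom_add) auto
    also have "\<dots> = coset I s" using c coset_eq_zero_iff[OF I(1)] by (simp add: s_def)
    finally show "x \<in> coset I ` CS.Span constants bs" using x sum_in[OF B(1)] by (auto simp: s_def)
  qed
  moreover have "coset I ` CS.Span constants bs \<subseteq> carrier (CS Quot I)" unfolding carrier_quotient by blast
  moreover have "hom.Span (coset I ` constants) (map (coset I) bs) = coset I ` CS.Span constants bs"
    by (rule hom.Span_hom) auto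
  moreover have "hom.finite_dimension (coset I ` constants) (hom.Span (coset I ` constants) (map (coset I) bs))"
    by (rule hom.Span_finite_dimension[OF quotient_hom(3)[OF I]]) (auto simp: carrier_quotient)
  ultimately show ?thesis by (metis subset_antisym)
qed

lemma combine_zeros: "set (take (length us) ks) \<subseteq> {0} \<Longrightarrow> CS.combine ks us = 0"
  by (induction ks us rule: CS.combine.induct) auto

text \<open>Lifts of a basis modulo I, together with f, are independent modulo J, which gives m + 1
  independent elements.\<close>

lemma quotient_dimension_less:
  assumes I: "ideals.subspace I" "1 \<notin> I" and J: "ideals.subspace J" "J \<subseteq> I"
    and f: "f \<in> I" "f \<notin> J"
    and m: "ring.dimension (CS Quot I) m (coset I ` constants) (carrier (CS Quot I))"
    and n: "ring.dimension (CS Quot J) n (coset J ` constants) (carrier (CS Quot J))"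
  shows "m < n"
proof -
  have J1: "1 \<notin> J" using I J by blast
  interpret hI: ring_hom_ring CS "CS Quot I" "coset I" by (rule quotient_hom[OF I])
  interpret hJ: ring_hom_ring CS "CS Quot J" "coset J" by (rule quotient_hom[OF J(1) J1])
  note fI = quotient_hom(3)[OF I] and fJ = quotient_hom(3)[OF J(1) J1]
  obtain Us where Us: "set Us \<subseteq> carrier (CS Quot I)" "hI.independent (coset I ` constants) Us" "length Us = m"
    using hI.exists_base[OF fI m] by blast
  have "\<exists>us. Us = map (coset I) us"
    unfolding ex_map_conv using Us(1) by (auto simp: carrier_quotient)
  then obtain us where us: "Us = map (coset I) us" by blast
  have "hJ.independent (coset J ` constants) (map (coset J) (f # us))"
  proof (rule hJ.trivial_combine_imp_independent[OF fJ])
    show "set (map (coset J) (f # us)) \<subseteq> carrier (CS Quot J)" by (auto simp: carrier_quotient)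
    fix Ks assume Ks: "set Ks \<subseteq> coset J ` constants"
      and comb: "hJ.combine Ks (map (coset J) (f # us)) = \<zero>\<^bsub>CS Quot J\<^esub>"
    have "\<exists>zs. Ks = map (\<lambda>z. coset J (cs_const z)) zs"
      unfolding ex_map_conv using Ks by auto
    then obtain zs where zs: "Ks = map (\<lambda>z. coset J (cs_const z)) zs" by blast
    define ks where "ks = map cs_const zs"
    have ks: "Ks = map (coset J) ks" "set ks \<subseteq> constants" by (auto simp: ks_def zs)
    have "coset J (CS.combine ks (f # us)) = \<zero>\<^bsub>CS Quot J\<^esub>"
      using comb unfolding ks(1) by (subst (asm) hJ.combine_hom) auto
    then have inJ: "CS.combine ks (f # us) \<in> J" using coset_eq_zero_iff[OF J(1)] by blast
    \<comment> \<open>\<open>combine\<close> ignores surplus scalars, hence the \<open>take\<close>.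
      Modulo I the term with f disappears, so the other scalars vanish; then k f lies in J, which
      forces k = 0.\<close>
    have "set (take (length (f # us)) ks) \<subseteq> {0}"
    proof (cases ks)
      case (Cons k ks')
      have kf: "k * f + CS.combine ks' us \<in> J" using inJ Cons by simp
      have "(k * f + CS.combine ks' us) - k * f \<in> I"
        using kf J(2) f(1) ideals.subspace_diff[OF I(1)] ideals.subspace_scale[OF I(1)] by blast
      then have "coset I (CS.combine ks' us) = \<zero>\<^bsub>CS Quot I\<^esub>" using coset_eq_zero_iff[OF I(1)] by simp
      then have "hI.combine (map (coset I) ks') (map (coset I) us) = \<zero>\<^bsub>CS Quot I\<^esub>"
        by (subst hI.combine_hom) auto
      then have triv: "set (take (length Us) (map (coset I) ks')) \<subseteq> {\<zero>\<^bsub>CS Quot I\<^esub>}"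
        using ks(2) Cons us by (intro hI.independent_imp_trivial_combine[OF fI Us(2)]) auto
      have const: "c = 0" if mem: "c \<in> constants" "c \<in> I" for c
      proof (rule ccontr)
        assume "c \<noteq> 0"
        obtain z where z: "c = cs_const z" using mem(1) by blast
        have "z \<noteq> 0" using \<open>c \<noteq> 0\<close> z cs_const_simps(5) by auto
        then have "cs_const (inverse z) * c = 1" by (simp add: z cs_const_inverse)
        then show False using ideals.subspace_scale[OF I(1) mem(2), of "cs_const (inverse z)"] I(2) by simp
      qed
      have zeros: "set (take (length us) ks') \<subseteq> {0}"
      proof
        fix c assume c: "c \<in> set (take (length us) ks')"
        then have "coset I c = \<zero>\<^bsub>CS Quot I\<^esub>" using triv by (auto simp: us take_map)
        then have "c \<in> I" using coset_eq_zero_iff[OF I(1)] by blast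
        moreover have "c \<in> constants" using c ks(2) Cons by (auto dest: in_set_takeD)
        ultimately show "c \<in> {0}" using const by blast
      qed
      then have kJ: "k * f \<in> J" using kf combine_zeros[OF zeros] by simp
      obtain z where z: "k = cs_const z" using ks(2) Cons by auto
      have "z = 0"
      proof (rule ccontr)
        assume "z \<noteq> 0"
        have eq: "cs_const (inverse z) * (k * f) = f"
          by (simp only: z mult.assoc[symmetric] cs_const_inverse[OF \<open>z \<noteq> 0\<close>] mult_1_left)
        show False using ideals.subspace_scale[OF J(1) kJ, of "cs_const (inverse z)"] f(2) unfolding eq by blast
      qed
      then show ?thesis using zeros Cons z cs_const_simps(5) by simp
    qed simp
    then show "set (take (length (map (coset J) (f # us))) Ks) \<subseteq> {\<zero>\<^bsub>CS Quot J\<^esub>}"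
      using coset_eq_zero_iff[OF J(1), of 0] ideals.subspace_0[OF J(1)] unfolding ks(1) take_map by auto
  qed
  then have "length (map (coset J) (f # us)) \<le> n"
    by (rule hJ.independent_length_le_dimension[OF fJ n]) (auto simp: carrier_quotient)
  then show ?thesis using Us(3) us by simp
qed

lemma quotient_dim_eq:
  "quotient_dim S =
     (let I = ideals.span S; Q = CS Quot I; K = coset I ` constants
      in if ring.finite_dimension Q K (carrier Q) then enat ((ring.dim Q over K) (carrier Q)) else \<infinity>)"
  unfolding quotient_dim_def Idl_CS image_image ..

lemma tjurina_eq_milnor_iff:
  assumes sqf: "squarefree f" and ord: "order_ge 2 f"
  shows "tjurina_number f = milnor_number f \<longleftrightarrow> f \<in> jacobian_ideal f"
proof
  assume "f \<in> jacobian_ideal f"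
  then have "{f, deriv_x f, deriv_y f} \<subseteq> ideals.span {deriv_x f, deriv_y f}"
    unfolding jacobian_ideal_def by (auto intro: ideals.span_base)
  then have "ideals.span {f, deriv_x f, deriv_y f} \<subseteq> ideals.span {deriv_x f, deriv_y f}"
    by (intro ideals.span_minimal) auto
  moreover have "ideals.span {deriv_x f, deriv_y f} \<subseteq> ideals.span {f, deriv_x f, deriv_y f}"
    by (intro ideals.span_mono) auto
  ultimately have "ideals.span {f, deriv_x f, deriv_y f} = ideals.span {deriv_x f, deriv_y f}" by blast
  then show "tjurina_number f = milnor_number f"
    by (simp only: tjurina_number_def milnor_number_def quotient_dim_eq)
next
  assume eq: "tjurina_number f = milnor_number f"
  define I where "I = tjurina_ideal f"
  define J where "J = jacobian_ideal f"
  have I: "ideals.subspace I" "1 \<notin> I" "no_common_divisor I"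
    using tjurina_ideal_subspace tjurina_ideal_proper[OF ord, of 1] tjurina_ideal_no_common_divisor[OF sqf]
    by (auto simp: I_def)
  have J: "ideals.subspace J" "J \<subseteq> I"
    unfolding I_def J_def jacobian_ideal_def tjurina_ideal_def by (simp, intro ideals.span_mono, auto)
  have J1: "1 \<notin> J" using I J by blast
  define K where "K = coset I ` constants"
  define L where "L = coset J ` constants"
  have fin: "ring.finite_dimension (CS Quot I) K (carrier (CS Quot I))"
    unfolding K_def by (rule quotient_finite_dimension[OF I])
  have tj: "tjurina_number f = enat ((ring.dim (CS Quot I) over K) (carrier (CS Quot I)))"
    using fin by (simp add: tjurina_number_def quotient_dim_eq Let_def K_def I_def tjurina_ideal_def)
  have mil: "milnor_number f = (if ring.finite_dimension (CS Quot J) L (carrier (CS Quot J))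
      then enat ((ring.dim (CS Quot J) over L) (carrier (CS Quot J))) else \<infinity>)"
    by (simp add: milnor_number_def quotient_dim_eq Let_def L_def J_def jacobian_ideal_def)
  \<comment> \<open>As the Tjurina number is finite, equality rules out an infinite Milnor
    number.\<close>
  have finJ: "ring.finite_dimension (CS Quot J) L (carrier (CS Quot J))"
    using eq unfolding tj mil by (auto split: if_splits)
  have dim: "(ring.dim (CS Quot I) over K) (carrier (CS Quot I)) = (ring.dim (CS Quot J) over L) (carrier (CS Quot J))"
    using eq finJ unfolding tj mil by simp
  have ringI: "ring (CS Quot I)" and ringJ: "ring (CS Quot J)"
    using ideal.quotient_is_ring ideal_CS I(1) J(1) by blast+
  note dI = ring.finite_dimensionE[OF ringI quotient_hom(3)[OF I(1,2)] fin[unfolded K_def]]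
  note dJ = ring.finite_dimensionE[OF ringJ quotient_hom(3)[OF J(1) J1] finJ[unfolded L_def]]
  show "f \<in> jacobian_ideal f"
  proof (rule ccontr)
    assume "f \<notin> jacobian_ideal f"
    then have "(ring.dim (CS Quot I) over K) (carrier (CS Quot I)) < (ring.dim (CS Quot J) over L) (carrier (CS Quot J))"
      using quotient_dimension_less[OF I(1,2) J _ _ dI dJ, of f] tjurina_ideal_gens(1)[of f]
      by (simp add: I_def J_def K_def L_def)
    then show False using dim by simp
  qed
qed

section \<open>Translation of the torsion module from cosets to forms\<close>

lemma torsion_module_carrier:
  "carrier (torsion_module f) = (\<lambda>\<omega>. F_module f +>\<^bsub>Omega1\<^esub> \<omega>) ` saito_module f"
  by (auto simp: torsion_module_def)

lemma nontrivial_torsion_module_iff: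
  "nontrivial_module (torsion_module f) \<longleftrightarrow> (\<exists>\<omega>\<in>saito_module f. \<omega> \<notin> F_module f)"
proof -
  have zero: "F_module f = F_module f +>\<^bsub>Omega1\<^esub> 0" by (auto simp: Omega1_coset)
  have z: "\<zero>\<^bsub>torsion_module f\<^esub> = F_module f +>\<^bsub>Omega1\<^esub> 0"
    by (subst zero[symmetric]) (simp add: torsion_module_def kaehler_module_def)
  have "0 \<in> saito_module f"
    using F_module_subset_saito_module forms.subspace_0[OF subspace_F_module] by blast
  then show ?thesis
    unfolding nontrivial_module_def torsion_module_carrier z
    using kaehler_coset_eq_iff[of f _ 0] by auto
qed

lemma cyclic_torsion_module_iff:
  assumes S: "forms.subspace (saito_module f)"
  shows "cyclic_module (local_ring f) (torsion_module f) \<longleftrightarrow>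
    (\<exists>\<omega>\<in>saito_module f. \<forall>u\<in>saito_module f. \<exists>p. u - form_scale p \<omega> \<in> F_module f)"
proof -
  define C where "C \<omega> = F_module f +>\<^bsub>Omega1\<^esub> \<omega>" for \<omega>
  have R: "carrier (local_ring f) = range (coset (PIdl\<^bsub>CS\<^esub> f))"
    unfolding local_ring_def by (rule carrier_quotient)
  have smult: "coset (PIdl\<^bsub>CS\<^esub> f) p \<odot>\<^bsub>torsion_module f\<^esub> C \<omega> = C (form_scale p \<omega>)" for p \<omega>
    using kaehler_smult[of f p \<omega>] by (simp add: torsion_module_def C_def)
  have set: "{r \<odot>\<^bsub>torsion_module f\<^esub> C \<omega> | r. r \<in> carrier (local_ring f)} = range (\<lambda>p. C (form_scale p \<omega>))" for \<omega>
  proof -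
    have "{r \<odot>\<^bsub>torsion_module f\<^esub> C \<omega> | r. r \<in> carrier (local_ring f)}
        = range (\<lambda>p. coset (PIdl\<^bsub>CS\<^esub> f) p \<odot>\<^bsub>torsion_module f\<^esub> C \<omega>)"
      unfolding R by blast
    then show ?thesis unfolding smult .
  qed
  have C_eq: "C u = C v \<longleftrightarrow> u - v \<in> F_module f" for u v
    unfolding C_def by (rule kaehler_coset_eq_iff)
  have range: "C ` saito_module f = range (\<lambda>p. C (form_scale p \<omega>))
      \<longleftrightarrow> (\<forall>u\<in>saito_module f. \<exists>p. u - form_scale p \<omega> \<in> F_module f)" if "\<omega> \<in> saito_module f" for \<omega>
  proof -
    have "C (form_scale p \<omega>) \<in> C ` saito_module f" for p
      by (rule imageI) (rule forms.subspace_scale[OF S that])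
    then have "C ` saito_module f = range (\<lambda>p. C (form_scale p \<omega>))
        \<longleftrightarrow> C ` saito_module f \<subseteq> range (\<lambda>p. C (form_scale p \<omega>))"
      unfolding set_eq_subset by (simp add: image_subset_iff)
    also have "\<dots> \<longleftrightarrow> (\<forall>u\<in>saito_module f. \<exists>p. C u = C (form_scale p \<omega>))"
      unfolding image_subset_iff by (simp only: image_iff bex_UNIV)
    finally show ?thesis unfolding C_eq .
  qed
  have "cyclic_module (local_ring f) (torsion_module f)
      \<longleftrightarrow> (\<exists>\<omega>\<in>saito_module f. C ` saito_module f = range (\<lambda>p. C (form_scale p \<omega>)))"
    unfolding cyclic_module_def torsion_module_carrier C_def[symmetric] by (simp only: bex_simps(7) set)
  also have "\<dots> \<longleftrightarrow> (\<exists>\<omega>\<in>saito_module f. \<forall>u\<in>saito_module f. \<exists>p. u - form_scale p \<omega> \<in> F_module f)"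
    by (rule bex_cong[OF refl range])
  finally show ?thesis .
qed

theorem theorem2p9:
  fixes f :: conv_series
  assumes "squarefree f" and "multiplicity0 f > 1"
  shows "(tjurina_number f = milnor_number f \<longleftrightarrow>
            (\<exists>\<omega>\<in>saito_module f. saito_basis f {\<omega>, differential f})) \<and>
         ((\<exists>\<omega>\<in>saito_module f. saito_basis f {\<omega>, differential f}) \<longleftrightarrow>
            nontrivial_module (torsion_module f) \<and> cyclic_module (local_ring f) (torsion_module f))"
proof -
  note sqf = assms(1)
  have "f \<noteq> 0" using sqf by auto
  \<comment> \<open>Order at least 2 means that f, f_x and f_y all vanish at the origin.\<close>
  then have ord: "order_ge 2 f" using assms(2) by (intro order_ge_mono[OF order_ge_multiplicity0]) auto
  have "nontrivial_module (torsion_module f) \<and> cyclic_module (local_ring f) (torsion_module f)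
      \<longleftrightarrow> f \<in> jacobian_ideal f"
    unfolding nontrivial_torsion_module_iff cyclic_torsion_module_iff[OF saito_module_subspace[OF sqf]]
  proof
    assume "f \<in> jacobian_ideal f"
    from jacobian_imp_cyclic_nontrivial[OF sqf ord this]
    obtain \<omega> where \<omega>: "\<omega> \<in> saito_module f"
      "\<omega> \<notin> F_module f \<and> (\<forall>u\<in>saito_module f. \<exists>p. u - form_scale p \<omega> \<in> F_module f)"
      by (rule bexE)
    show "(\<exists>\<omega>\<in>saito_module f. \<omega> \<notin> F_module f) \<and>
        (\<exists>\<omega>\<in>saito_module f. \<forall>u\<in>saito_module f. \<exists>p. u - form_scale p \<omega> \<in> F_module f)"
      by (intro conjI bexI[OF _ \<omega>(1)] \<omega>(2)[THEN conjunct1] \<omega>(2)[THEN conjunct2])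
  next
    assume "(\<exists>\<omega>\<in>saito_module f. \<omega> \<notin> F_module f) \<and>
        (\<exists>\<omega>\<in>saito_module f. \<forall>u\<in>saito_module f. \<exists>p. u - form_scale p \<omega> \<in> F_module f)"
    then obtain \<omega> where \<omega>: "\<omega> \<in> saito_module f"
      "\<forall>u\<in>saito_module f. \<exists>p. u - form_scale p \<omega> \<in> F_module f" by (elim conjE bexE)
    show "f \<in> jacobian_ideal f" by (rule cyclic_imp_jacobian[OF sqf ord \<omega>(1) \<omega>(2)[rule_format]])
  qed
  then show ?thesis using tjurina_eq_milnor_iff[OF sqf ord] saito_basis_iff_jacobian[OF sqf] by blast
qed

end
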